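(* Let $\lambda$ be a cardinal with $\mathrm{cf}(\lambda)=\omega$, $2^\lambda = \lambda^+$, and $2^\mu < \lambda$ for all $\mu<\lambda$, and suppose $*(\lambda,\aleph_0)$ holds. Then there is a non-free coseparable abelian group of cardinality $\lambda^+$.
   Context: All groups are abelian. The principle $*(\lambda,\aleph_0)$ asserts: there is a family $\{S_i : i<\lambda^+\}$ of countable subsets of $\lambda$ such that for every $I\subseteq\lambda^+$ of cardinality $\lambda$ there are sets $\{S_i^* : i\in I\}$ with $S_i\setminus S_i^*$ finite for all $i\in I$ and $S_i^*\cap S_j^*=\emptyset$ for all distinct $i,j\in I$. A group $A$ is coseparable if it is $\aleph_1$-free (every countable subgroup free) and every subgroup $B$ with $A/B$ finitely generated contains a direct summand $C$ of $A$ with $A/C$ finitely generated; equivalently, for every prime $p$ every homomorphism $A\to\mathbb{Z}/p\mathbb{Z}$ lifts to a homomorphism $A\to\mathbb{Z}$. *)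

theory Defs
  imports "HOL-Algebra.Free_Abelian_Groups"
begin

text \<open>Cardinals are the cardinal orders of the BNF cardinal library. For a cardinal
  \<open>r\<close>, the set of ordinals below it is \<open>Field r\<close>, ordered by \<open>r\<close>.\<close>

definition has_cofinality :: "'a rel \<Rightarrow> 'b rel \<Rightarrow> bool" where
  "has_cofinality r k \<longleftrightarrow>
     (\<exists>A \<subseteq> Field r. cofinal A r \<and> |A| =o k) \<and>
     (\<forall>A \<subseteq> Field r. cofinal A r \<longrightarrow> k \<le>o |A| )"

text \<open>In the following principle ``countable subset'' means a set of cardinality \<open>\<aleph>\<^sub>0\<close>: with finite
  sets \<open>S i\<close> allowed, the principle would hold trivially (take every \<open>S i\<close> empty).\<close>

definition star_aleph0 :: "'a rel \<Rightarrow> bool" where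
  "star_aleph0 r \<longleftrightarrow>
     (\<exists>S :: 'a set \<Rightarrow> 'a set.
        (\<forall>i \<in> Field (cardSuc r). S i \<subseteq> Field r \<and> countable (S i) \<and> infinite (S i)) \<and>
        (\<forall>I \<subseteq> Field (cardSuc r). |I| =o r \<longrightarrow>
           (\<exists>T :: 'a set \<Rightarrow> 'a set.
              (\<forall>i \<in> I. finite (S i - T i)) \<and>
              (\<forall>i \<in> I. \<forall>j \<in> I. i \<noteq> j \<longrightarrow> T i \<inter> T j = {}))))"

text \<open>Abelian groups are written multiplicatively, as \<^const>\<open>comm_group\<close>s. A free abelian group has a
  basis inside its carrier, so it is no restriction that \<open>S\<close> has the type of the carrier.\<close>

definition free_abelian :: "('a, 'm) monoid_scheme \<Rightarrow> bool" where
  "free_abelian G \<longleftrightarrow> comm_group G \<and> (\<exists>S :: 'a set. G \<cong> free_Abelian_group S)"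

definition aleph1_free :: "('a, 'm) monoid_scheme \<Rightarrow> bool" where
  "aleph1_free G \<longleftrightarrow> comm_group G \<and>
     (\<forall>H. subgroup H G \<and> countable H \<longrightarrow> free_abelian (G\<lparr>carrier := H\<rparr>))"

definition fin_generated :: "('a, 'm) monoid_scheme \<Rightarrow> bool" where
  "fin_generated G \<longleftrightarrow> (\<exists>X \<subseteq> carrier G. finite X \<and> generate G X = carrier G)"

definition direct_summand :: "'a set \<Rightarrow> ('a, 'm) monoid_scheme \<Rightarrow> bool" where
  "direct_summand C G \<longleftrightarrow> subgroup C G \<and>
     (\<exists>D. subgroup D G \<and> C \<inter> D = {\<one>\<^bsub>G\<^esub>} \<and> C <#>\<^bsub>G\<^esub> D = carrier G)"

definition coseparable :: "('a, 'm) monoid_scheme \<Rightarrow> bool" where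
  "coseparable G \<longleftrightarrow> aleph1_free G \<and>
     (\<forall>B. subgroup B G \<and> fin_generated (G Mod B) \<longrightarrow>
        (\<exists>C \<subseteq> B. direct_summand C G \<and> fin_generated (G Mod C)))"

end

theory Submission
  imports Defs "HOL-Computational_Algebra.Group_Closure" "HOL-Algebra.Weak_Morphisms"
begin

text \<open>Let \<open>F\<close> be free on \<open>\<lambda> \<times> \<lambda>\<close>. For each \<open>i < \<lambda>\<^sup>+\<close> adjoin to \<open>F\<close> elements \<open>y i n\<close> with
  \<open>y i n = (n + 1) y i (n + 1) + a i n\<close>, where \<open>a i n\<close> is a difference of two basis elements in the row
  given by the \<open>n\<close>-th element of \<open>S i\<close>. The quotient of the resulting group \<open>G\<close> by \<open>F\<close> is divisible, so
  \<open>G\<close> is not free, and a homomorphism from \<open>G\<close> to \<open>\<int>/m\<close> is determined by its restriction to \<open>F\<close>.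
  By \<open>*(\<lambda>, \<aleph>\<^sub>0)\<close>, any \<open>\<lambda>\<close> many of the chains \<open>y i\<close> generate together with \<open>F\<close> a free group, which has a
  basis containing all but at most one of the elements of each row.

  Since \<open>2\<^sup>\<lambda> = \<lambda>\<^sup>+\<close>, the homomorphisms from \<open>F\<close> to the groups \<open>\<int>/m\<close> can be enumerated in type \<open>\<lambda>\<^sup>+\<close>. At step
  \<open>i\<close> lift the \<open>i\<close>-th one, if possible, to \<open>\<int>\<close> on the group generated so far, with finitely many values
  in each row; then choose the \<open>a i n\<close> such that each of the \<open>\<lambda>\<close> lifts obtained up to now vanishes at
  almost all of them. Such a choice exists because \<open>\<lambda>\<close> is a union of countably many smaller cardinals
  \<open>\<mu>\<close>, and \<open>2\<^sup>\<mu> < \<lambda>\<close> allows a pigeonhole argument in each row. A homomorphism to \<open>\<int>\<close> that vanishes at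
  almost all \<open>a i n\<close> extends to the chain \<open>y i\<close>, so the lifts extend to all of \<open>G\<close>.\<close>

section \<open>Subgroups of free abelian groups\<close>

lemma finite_greatest_wrt:
  assumes "finite A" "A \<noteq> {}" and r: "total r" "trans r" "refl r"
  shows "\<exists>m\<in>A. \<forall>a\<in>A. (a, m) \<in> r"
  using assms(1,2)
proof (induction A rule: finite_ne_induct)
  case (singleton x)
  then show ?case using r(3) by (auto dest: refl_onD)
next
  case (insert x A)
  then obtain m where m: "m \<in> A" "\<And>a. a \<in> A \<Longrightarrow> (a, m) \<in> r" by blast
  show ?case
  proof (cases "(x, m) \<in> r")
    case True
    then show ?thesis using m by blast
  next
    case False
    then have "(m, x) \<in> r" using r(1,3) by (metis UNIV_I refl_onD total_on_def)
    then have "\<forall>a\<in>insert x A. (a, x) \<in> r" using m r by (auto dest: refl_onD transD)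
    then show ?thesis by blast
  qed
qed

text \<open>Division with remainder by the least positive element. The result serves for leading
  coefficients, for the order of an element modulo a subgroup and for the image of a homomorphism to
  the integers.\<close>

lemma int_diff_closed_principal:
  fixes J :: "int set"
  assumes J0: "0 \<in> J" and Jd: "\<And>x y. x \<in> J \<Longrightarrow> y \<in> J \<Longrightarrow> x - y \<in> J"
  shows "\<exists>d\<in>J. \<forall>x\<in>J. d dvd x"
proof (cases "J \<subseteq> {0}")
  case True
  then show ?thesis using J0 by auto
next
  case False
  have Jm: "- x \<in> J" if "x \<in> J" for x using Jd[OF J0 that] by simp
  have Ja: "x + y \<in> J" if "x \<in> J" "y \<in> J" for x y using Jd[OF that(1) Jm[OF that(2)]] by simp
  have Jn: "int n * x \<in> J" if "x \<in> J" for n x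
    using that by (induction n) (auto simp: J0 Ja algebra_simps)
  have Jk: "k * x \<in> J" if "x \<in> J" for k x
    using Jn[OF that, of "nat k"] Jm[OF Jn[OF that, of "nat (- k)"]] by (cases "k \<ge> 0") auto
  obtain x where "x \<in> J" "x \<noteq> 0" using False by auto
  then have "\<exists>n. 0 < n \<and> int n \<in> J"
    using Jm[of x] by (intro exI[of _ "nat \<bar>x\<bar>"]) (auto simp: abs_if)
  define d where "d = (LEAST n. 0 < n \<and> int n \<in> J)"
  have d: "0 < d" "int d \<in> J"
    using LeastI_ex[OF \<open>\<exists>n. 0 < n \<and> int n \<in> J\<close>] by (auto simp: d_def)
  have "int d dvd x" if "x \<in> J" for x
  proof -
    have "x mod int d \<in> J" using Jd[OF that Jk[OF d(2), of "x div int d"]]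
      by (simp add: minus_div_mult_eq_mod)
    moreover have "x mod int d \<ge> 0" "x mod int d < int d" using d by auto
    ultimately have "\<not> 0 < nat (x mod int d)"
      using not_less_Least[of "nat (x mod int d)" "\<lambda>n. 0 < n \<and> int n \<in> J"]
      by (auto simp: d_def)
    then show ?thesis using \<open>x mod int d \<ge> 0\<close> by (simp add: dvd_eq_mod_eq_0)
  qed
  then show ?thesis using d by blast
qed

text \<open>Well-order the index set and choose, for each index, an element of the subgroup with this
  index leading and with smallest possible leading coefficient.\<close>

lemma diff_closed_frag_basis:
  fixes K :: "('b \<Rightarrow>\<^sub>0 int) set"
  assumes K0: "0 \<in> K" and Kd: "\<And>x y. x \<in> K \<Longrightarrow> y \<in> K \<Longrightarrow> x - y \<in> K"
  shows "\<exists>(L :: 'b set) f. frag_extend f ` {c. Poly_Mapping.keys c \<subseteq> L} = K \<and>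
    (\<forall>c. Poly_Mapping.keys c \<subseteq> L \<longrightarrow> frag_extend f c = 0 \<longrightarrow> c = 0)"
proof -
  obtain r :: "'b rel" where r: "well_order r" using well_order_on[of "UNIV :: 'b set"] by blast
  have tot: "total r" and tr: "trans r" and re: "refl r" and an: "antisym r" and wf: "wf (r - Id)"
    using r by (auto simp: well_order_on_def linear_order_on_def partial_order_on_def preorder_on_def)
  have max: "\<exists>m\<in>Poly_Mapping.keys c. \<forall>a\<in>Poly_Mapping.keys c. (a, m) \<in> r" if "c \<noteq> 0"
    for c :: "'b \<Rightarrow>\<^sub>0 int"
    using finite_greatest_wrt[OF _ _ tot tr re] that by simp
  define D where "D t = {g \<in> K. \<forall>s\<in>Poly_Mapping.keys g. (s, t) \<in> r}" for t
  have D0: "0 \<in> D t" for t by (simp add: D_def K0)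
  have Dd: "x - y \<in> D t" if "x \<in> D t" "y \<in> D t" for x y t
    using that Kd keys_diff[of x y] by (auto simp: D_def)
  have "\<exists>g\<in>D t. \<forall>h\<in>D t. Poly_Mapping.lookup g t dvd Poly_Mapping.lookup h t" for t
  proof -
    have "\<exists>d\<in>(\<lambda>g. Poly_Mapping.lookup g t) ` D t. \<forall>x\<in>(\<lambda>g. Poly_Mapping.lookup g t) ` D t. d dvd x"
    proof (rule int_diff_closed_principal)
      show "0 \<in> (\<lambda>g. Poly_Mapping.lookup g t) ` D t"
        by (rule image_eqI[of _ _ 0]) (auto simp: D0)
      fix x y assume "x \<in> (\<lambda>g. Poly_Mapping.lookup g t) ` D t" "y \<in> (\<lambda>g. Poly_Mapping.lookup g t) ` D t"
      then obtain g h where "g \<in> D t" "h \<in> D t" "x = Poly_Mapping.lookup g t" "y = Poly_Mapping.lookup h t" by auto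
      then show "x - y \<in> (\<lambda>g. Poly_Mapping.lookup g t) ` D t"
        by (intro image_eqI[of _ _ "g - h"]) (auto simp: Dd lookup_minus)
    qed
    then show ?thesis by auto
  qed
  then obtain f where f: "\<And>t. f t \<in> D t"
    "\<And>t h. h \<in> D t \<Longrightarrow> Poly_Mapping.lookup (f t) t dvd Poly_Mapping.lookup h t" by metis
  \<comment> \<open>For \<open>t\<close> outside \<open>L\<close> every member of \<open>D t\<close>
    has coefficient 0 at \<open>t\<close>, so \<open>f t\<close> is left out of the basis.\<close>
  define L where "L = {t. Poly_Mapping.lookup (f t) t \<noteq> 0}"
  let ?M = "frag_extend f ` {c. Poly_Mapping.keys c \<subseteq> L}"
  have M0: "0 \<in> ?M" by (rule image_eqI[of _ _ 0]) auto
  have Md: "x - y \<in> ?M" if xy: "x \<in> ?M" "y \<in> ?M" for x y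
  proof -
    obtain c d where "x = frag_extend f c" "y = frag_extend f d" "Poly_Mapping.keys c \<subseteq> L" "Poly_Mapping.keys d \<subseteq> L"
      using xy by auto
    then show ?thesis
      using keys_diff[of c d] by (intro image_eqI[of _ _ "c - d"]) (auto simp: frag_extend_diff)
  qed
  have fM: "frag_cmul k (f t) \<in> ?M" if "t \<in> L" for k t
    by (rule frag_closure_minus_cmul[of "\<lambda>x. x \<in> ?M"], rule M0, rule Md, assumption+)
      (rule image_eqI[of _ _ "frag_of t"], use that in auto)
  \<comment> \<open>Subtracting a multiple of \<open>f t\<close> removes the coefficient at
    \<open>t\<close>; the difference is 0 or has a smaller leading index, where the induction
    hypothesis applies.\<close>
  have lead: "g \<in> ?M" if "g \<in> D t" for t g
    using wf that
  proof (induction t arbitrary: g rule: wf_induct_rule)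
    case (less t)
    have "\<exists>k. Poly_Mapping.lookup g t = k * Poly_Mapping.lookup (f t) t \<and> (t \<notin> L \<longrightarrow> k = 0)"
      using f(2)[OF less.prems] by (cases "t \<in> L") (auto simp: L_def dvd_def mult.commute)
    then obtain k where k: "Poly_Mapping.lookup g t = k * Poly_Mapping.lookup (f t) t"
      and k0: "t \<notin> L \<Longrightarrow> k = 0" by blast
    define h where "h = g - frag_cmul k (f t)"
    have "frag_cmul k (f t) \<in> D t"
      by (rule frag_closure_minus_cmul[of "\<lambda>x. x \<in> D t"]) (auto simp: D0 Dd f)
    then have hD: "h \<in> D t" using Dd less.prems by (simp add: h_def)
    have h0: "Poly_Mapping.lookup h t = 0" by (simp add: h_def lookup_minus k)
    have "h \<in> ?M"
    proof (cases "h = 0")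
      case False
      then obtain m where m: "m \<in> Poly_Mapping.keys h" "\<forall>a\<in>Poly_Mapping.keys h. (a, m) \<in> r" using max by blast
      then have "(m, t) \<in> r - Id" using hD h0 by (auto simp: D_def in_keys_iff)
      moreover have "h \<in> D m" using hD m by (auto simp: D_def)
      ultimately show ?thesis using less.IH by blast
    qed (use M0 in simp)
    moreover have "frag_cmul k (f t) \<in> ?M"
      using fM[of t] M0 k0 by (cases "t \<in> L") auto
    ultimately show ?case using Md[OF \<open>h \<in> ?M\<close> Md[OF M0 \<open>frag_cmul k (f t) \<in> ?M\<close>]]
      unfolding h_def diff_0 diff_minus_eq_add diff_add_cancel by blast
  qed
  have fK: "f t \<in> K" for t using f(1)[of t] by (simp add: D_def)
  have MK: "frag_extend f c \<in> K" for c
    using subset_UNIV[of "Poly_Mapping.keys c"]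
    by (induction c rule: frag_induction) (auto simp: K0 fK Kd frag_extend_diff)
  show ?thesis
  proof (intro exI[of _ L] exI[of _ f] conjI allI impI)
    show "?M = K"
    proof
      show "?M \<subseteq> K" using MK by auto
      show "K \<subseteq> ?M"
      proof
        fix g assume g: "g \<in> K"
        show "g \<in> ?M"
        proof (cases "g = 0")
          case False
          then obtain m where "m \<in> Poly_Mapping.keys g" "\<forall>a\<in>Poly_Mapping.keys g. (a, m) \<in> r" using max by blast
          then show ?thesis using g lead[of g m] by (simp add: D_def)
        qed (use M0 in simp)
      qed
    qed
    fix c assume c: "Poly_Mapping.keys c \<subseteq> L" "frag_extend f c = 0"
    show "c = 0"
    proof (rule ccontr)
      \<comment> \<open>At the largest index \<open>m\<close> of \<open>c\<close> only
        \<open>f m\<close> contributes, and its coefficient there is nonzero because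
        \<open>m\<close> is in \<open>L\<close>.\<close>
      assume "c \<noteq> 0"
      then obtain m where m: "m \<in> Poly_Mapping.keys c" "\<And>a. a\<in>Poly_Mapping.keys c \<Longrightarrow> (a, m) \<in> r" using max by blast
      have z: "Poly_Mapping.lookup (f i) m = 0" if "i \<in> Poly_Mapping.keys c" "i \<noteq> m" for i
      proof -
        have "(m, i) \<notin> r" using m(2)[OF that(1)] that(2) an by (auto dest: antisymD)
        then show ?thesis using f(1)[of i] by (auto simp: D_def in_keys_iff)
      qed
      have "Poly_Mapping.lookup (frag_extend f c) m
          = (\<Sum>i\<in>Poly_Mapping.keys c. Poly_Mapping.lookup c i * Poly_Mapping.lookup (f i) m)"
        by (simp add: frag_extend_def lookup_sum)
      also have "\<dots> = (\<Sum>i\<in>{m}. Poly_Mapping.lookup c i * Poly_Mapping.lookup (f i) m)"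
        using m(1) z by (intro sum.mono_neutral_right) auto
      finally show False using m(1) c by (auto simp: L_def in_keys_iff)
    qed
  qed
qed

text \<open>The image of \<open>\<phi>\<close> is closed under differences, so it has a basis by the
  previous lemma, which is pulled back along \<open>\<phi>\<close>.\<close>

lemma free_abelian_if_embeds:
  fixes G :: "('a, 'm) monoid_scheme" and T :: "'b set"
  assumes G: "comm_group G" and \<phi>: "\<phi> \<in> hom G (free_Abelian_group T)" "inj_on \<phi> (carrier G)"
  shows "free_abelian G"
proof -
  interpret G: comm_group G by (rule G)
  interpret \<phi>: group_hom G "free_Abelian_group T" \<phi>
    using \<phi>(1) by (simp add: group_hom_def group_hom_axioms_def)
  have diff: "\<phi> x - \<phi> y = \<phi> (x \<otimes>\<^bsub>G\<^esub> inv\<^bsub>G\<^esub> y)" if "x \<in> carrier G" "y \<in> carrier G" for x y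
    using that \<phi>.hom_closed[of y] by simp
  have "\<phi> \<one>\<^bsub>G\<^esub> = 0" by simp
  then have z: "0 \<in> \<phi> ` carrier G" by (metis G.one_closed imageI)
  have cl: "x - y \<in> \<phi> ` carrier G" if xy: "x \<in> \<phi> ` carrier G" "y \<in> \<phi> ` carrier G" for x y
  proof -
    obtain a b where "a \<in> carrier G" "b \<in> carrier G" "x = \<phi> a" "y = \<phi> b" using xy by auto
    then show ?thesis using diff by (intro image_eqI[of _ _ "a \<otimes>\<^bsub>G\<^esub> inv\<^bsub>G\<^esub> b"]) auto
  qed
  obtain L :: "'b set" and f where Lf: "frag_extend f ` {c. Poly_Mapping.keys c \<subseteq> L} = \<phi> ` carrier G"
    "\<And>c. Poly_Mapping.keys c \<subseteq> L \<Longrightarrow> frag_extend f c = 0 \<Longrightarrow> c = 0"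
    using diff_closed_frag_basis[OF z cl] by auto
  let ?h = "\<lambda>c. inv_into (carrier G) \<phi> (frag_extend f c)"
  have h: "?h c \<in> carrier G" "\<phi> (?h c) = frag_extend f c" if "Poly_Mapping.keys c \<subseteq> L" for c
    using that Lf(1) by (auto intro!: inv_into_into f_inv_into_f)
  have inj: "c = d" if "Poly_Mapping.keys c \<subseteq> L" "Poly_Mapping.keys d \<subseteq> L" "?h c = ?h d" for c d
  proof -
    have "frag_extend f c = frag_extend f d" using that h by metis
    then show ?thesis using Lf(2)[of "c - d"] keys_diff[of c d] that by (auto simp: frag_extend_diff)
  qed
  have iso: "?h \<in> iso (free_Abelian_group L) G"
  proof (rule isoI)
    show "?h \<in> hom (free_Abelian_group L) G"
    proof (rule homI)
      fix c d assume "c \<in> carrier (free_Abelian_group L)" "d \<in> carrier (free_Abelian_group L)"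
      then have cd: "Poly_Mapping.keys c \<subseteq> L" "Poly_Mapping.keys d \<subseteq> L" by auto
      then have k: "Poly_Mapping.keys (c + d) \<subseteq> L" using keys_add[of c d] by blast
      have "\<phi> (?h (c + d)) = \<phi> (?h c \<otimes>\<^bsub>G\<^esub> ?h d)"
        unfolding h(2)[OF k] using h cd by (simp add: frag_extend_add)
      then show "?h (c \<otimes>\<^bsub>free_Abelian_group L\<^esub> d) = ?h c \<otimes>\<^bsub>G\<^esub> ?h d"
        using inj_onD[OF \<phi>(2) _ h(1)[OF k]] h(1) cd by simp
    qed (use h in auto)
    show "bij_betw ?h (carrier (free_Abelian_group L)) (carrier G)"
    proof (rule bij_betw_imageI)
      show "inj_on ?h (carrier (free_Abelian_group L))" by (rule inj_onI) (use inj in auto)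
      show "?h ` carrier (free_Abelian_group L) = carrier G"
      proof
        show "carrier G \<subseteq> ?h ` carrier (free_Abelian_group L)"
        proof
          fix g assume g: "g \<in> carrier G"
          then obtain c where c: "Poly_Mapping.keys c \<subseteq> L" "\<phi> g = frag_extend f c" using Lf(1) by (metis (mono_tags, lifting) image_iff mem_Collect_eq)
          then have "?h c = g" using inv_into_f_f[OF \<phi>(2) g] by simp
          then show "g \<in> ?h ` carrier (free_Abelian_group L)" using c by force
        qed
        show "?h ` carrier (free_Abelian_group L) \<subseteq> carrier G" using h(1) by auto
      qed
    qed
  qed
  \<comment> \<open>\<open>L\<close> lives in the type of \<open>T\<close>; its copy
    \<open>S\<close> has the type of the carrier, as \<open>free_abelian\<close> demands.\<close>
  define S where "S = (\<lambda>l. ?h (frag_of l)) ` L"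
  have "inj_on (\<lambda>l. ?h (frag_of l)) L"
    using inj[of "frag_of _" "frag_of _"] by (intro inj_onI) (simp add: frag_of_eq)
  then have "L \<approx> S" unfolding S_def eqpoll_def by (auto simp: bij_betw_def)
  then have "free_Abelian_group L \<cong> free_Abelian_group S" by (simp add: isomorphic_free_Abelian_groups)
  moreover have "G \<cong> free_Abelian_group L"
    using iso group.iso_sym[OF group_free_Abelian_group] by (auto simp: is_iso_def)
  ultimately have "G \<cong> free_Abelian_group S" using iso_trans by blast
  then show ?thesis using G by (auto simp: free_abelian_def)
qed

section \<open>Lifting and coseparability\<close>

context comm_group
begin

lemma subgroup_mult_int_pows:
  assumes B: "subgroup B G" and x: "x \<in> carrier G"
  shows "subgroup {b \<otimes> x [^] k | b k. b \<in> B \<and> (k::int) \<in> UNIV} G"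
proof (rule subgroupI)
  note Bc = subgroup.mem_carrier[OF B]
  let ?S = "{b \<otimes> x [^] k | b k. b \<in> B \<and> (k::int) \<in> UNIV}"
  show "?S \<subseteq> carrier G" using Bc x by auto
  show "?S \<noteq> {}" using subgroup.one_closed[OF B] by auto
  fix a assume "a \<in> ?S"
  then obtain b k where a: "a = b \<otimes> x [^] (k::int)" "b \<in> B" by auto
  then have "inv a = inv b \<otimes> x [^] (- k)" using Bc x by (simp add: inv_mult int_pow_neg)
  then show "inv a \<in> ?S" using subgroup.m_inv_closed[OF B a(2)] by blast
  fix a' assume "a' \<in> ?S"
  then obtain b' k' where a': "a' = b' \<otimes> x [^] (k'::int)" "b' \<in> B" by auto
  have "a \<otimes> a' = (b \<otimes> b') \<otimes> x [^] (k + k')"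
    using a a' Bc x by (simp add: int_pow_mult m_ac)
  then show "a \<otimes> a' \<in> ?S" using subgroup.m_closed[OF B a(2) a'(2)] by blast
qed

lemma generate_insert_subgroup:
  assumes B: "subgroup B G" and x: "x \<in> carrier G"
  shows "generate G (insert x B) = {b \<otimes> x [^] k | b k. b \<in> B \<and> (k::int) \<in> UNIV}"
proof
  note Bc = subgroup.mem_carrier[OF B]
  have sub: "insert x B \<subseteq> carrier G" using Bc x by auto
  have "b \<otimes> x [^] (0::int) = b" if "b \<in> B" for b using Bc that by simp
  moreover have "\<one> \<otimes> x [^] (1::int) = x" using x by simp
  ultimately have "insert x B \<subseteq> {b \<otimes> x [^] k | b k. b \<in> B \<and> (k::int) \<in> UNIV}"
    using subgroup.one_closed[OF B] by (smt (verit) UNIV_I insert_subset mem_Collect_eq subsetI)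
  then show "generate G (insert x B) \<subseteq> {b \<otimes> x [^] k | b k. b \<in> B \<and> (k::int) \<in> UNIV}"
    by (rule generate_subgroup_incl[OF _ subgroup_mult_int_pows[OF B x]])
  have gs: "subgroup (generate G (insert x B)) G" by (rule generate_is_subgroup[OF sub])
  have "x \<in> generate G (insert x B)" by (rule generate.incl) simp
  then have "x [^] k \<in> generate G (insert x B)" for k :: int
    using subgroup_int_pow_closed[OF gs] by simp
  moreover have "b \<in> generate G (insert x B)" if "b \<in> B" for b
    by (rule generate.incl) (simp add: that)
  ultimately show "{b \<otimes> x [^] k | b k. b \<in> B \<and> (k::int) \<in> UNIV} \<subseteq> generate G (insert x B)"
    using subgroup.m_closed[OF gs] by auto
qed

lemma generate_Un_generate:
  assumes "A \<subseteq> carrier G" "Y \<subseteq> carrier G"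
  shows "generate G (A \<union> generate G Y) = generate G (A \<union> Y)"
proof
  have AY: "A \<union> Y \<subseteq> carrier G" using assms by auto
  show "generate G (A \<union> generate G Y) \<subseteq> generate G (A \<union> Y)"
  proof (rule generate_subgroup_incl[OF _ generate_is_subgroup[OF AY]])
    show "A \<union> generate G Y \<subseteq> generate G (A \<union> Y)"
      using mono_generate[of Y "A \<union> Y"] by (auto intro: generate.incl)
  qed
  show "generate G (A \<union> Y) \<subseteq> generate G (A \<union> generate G Y)"
    by (rule mono_generate) (auto intro: generate.incl)
qed

text \<open>The generators of the quotient are removed one at a time: the last one, \<open>x\<close>, gives a map from the
  summand \<open>C1\<close> found before to the cyclic group generated by \<open>x\<close> modulo \<open>B\<close>, and the kernel of a lift
  of this map to the integers splits off inside \<open>B\<close>.\<close>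

lemma complement_inside_subgroup_of_finite_corank:
  assumes lift: "\<And>(n::int) f. (\<And>a b. a \<in> carrier G \<Longrightarrow> b \<in> carrier G \<Longrightarrow> n dvd f (a \<otimes> b) - f a - f b) \<Longrightarrow>
      \<exists>h. (\<forall>a\<in>carrier G. \<forall>b\<in>carrier G. h (a \<otimes> b) = h a + h b) \<and> (\<forall>a\<in>carrier G. n dvd h a - f a)"
    and "finite X" "X \<subseteq> carrier G" "subgroup B G" "generate G (B \<union> X) = carrier G"
  shows "\<exists>C Y. C \<subseteq> B \<and> subgroup C G \<and> finite Y \<and> Y \<subseteq> carrier G \<and> C \<inter> generate G Y = {\<one>} \<and>
           C <#> generate G Y = carrier G"
  using assms(2-5)
proof (induction X arbitrary: B rule: finite_induct)
  case empty
  then have "B = carrier G"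
    using generate_subgroup_incl[of B B] by (metis Un_empty_right dual_order.refl subgroup.subset subset_antisym)
  have "C <#> {\<one>} = C" if "C \<subseteq> carrier G" for C using that by (auto simp: set_mult_def subset_iff)
  then show ?case
    using empty \<open>B = carrier G\<close> by (intro exI[of _ "carrier G"] exI[of _ "{}"]) (auto simp: generate_empty)
next
  case (insert x X)
  have x: "x \<in> carrier G" and X: "X \<subseteq> carrier G" using insert.prems by auto
  note B = \<open>subgroup B G\<close>
  note Bc = subgroup.mem_carrier[OF B]
  have Bsub: "B \<subseteq> carrier G" using Bc by auto
  let ?B1 = "generate G (insert x B)"
  have B1: "subgroup ?B1 G" by (rule generate_is_subgroup) (use Bsub x in auto)
  have "generate G (X \<union> ?B1) = generate G (X \<union> insert x B)"
    by (rule generate_Un_generate) (use X x Bsub in auto)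
  also have "X \<union> insert x B = B \<union> insert x X" by auto
  finally have "generate G (?B1 \<union> X) = carrier G" using insert.prems by (simp add: Un_commute)
  then obtain C1 Y where C1: "C1 \<subseteq> ?B1" "subgroup C1 G" and Y: "finite Y" "Y \<subseteq> carrier G"
    and dis: "C1 \<inter> generate G Y = {\<one>}" and tot: "C1 <#> generate G Y = carrier G"
    using insert.IH[OF X B1] by blast
  let ?D = "generate G Y"
  have D: "subgroup ?D G" by (rule generate_is_subgroup[OF Y(2)])
  note C1c = subgroup.mem_carrier[OF C1(2)] and Dc = subgroup.mem_carrier[OF D]
  have uniq: "c = c'" "d = d'" if "c \<in> C1" "c' \<in> C1" "d \<in> ?D" "d' \<in> ?D" "c \<otimes> d = c' \<otimes> d'" for c c' d d'
  proof -
    have car: "c \<in> carrier G" "c' \<in> carrier G" "d \<in> carrier G" "d' \<in> carrier G" using that C1c Dc by auto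
    have "inv c' \<otimes> c = inv c' \<otimes> (c \<otimes> d) \<otimes> inv d" using car by (simp add: m_assoc)
    also have "\<dots> = d' \<otimes> inv d" unfolding that(5) using car by (simp add: m_assoc[symmetric])
    finally have e: "inv c' \<otimes> c = d' \<otimes> inv d" .
    have "inv c' \<otimes> c \<in> C1" using that C1(2) by (simp add: subgroup.m_closed subgroup.m_inv_closed)
    moreover have "d' \<otimes> inv d \<in> ?D" using that D by (simp add: subgroup.m_closed subgroup.m_inv_closed)
    ultimately have one: "inv c' \<otimes> c = \<one>" "d' \<otimes> inv d = \<one>" using e dis by auto
    show "c = c'" using one(1) car by (metis inv_equality inv_inv inv_closed)
    show "d = d'" using one(2) car by (metis inv_equality inv_inv inv_closed)
  qed
  have ex: "\<exists>c d. c \<in> C1 \<and> d \<in> ?D \<and> a = c \<otimes> d" if "a \<in> carrier G" for a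
    using that unfolding tot[symmetric] by (auto simp: set_mult_def)
  \<comment> \<open>The quotient of \<open>?B1\<close> by \<open>B\<close> is the integers modulo
    \<open>n\<close>, where \<open>n = 0\<close> means an infinite cyclic quotient.\<close>
  have "\<exists>n\<in>{k::int. x [^] k \<in> B}. \<forall>k\<in>{k::int. x [^] k \<in> B}. n dvd k"
  proof (rule int_diff_closed_principal)
    show "0 \<in> {k::int. x [^] k \<in> B}" using subgroup.one_closed[OF B] by simp
    fix k l assume "k \<in> {k::int. x [^] k \<in> B}" "l \<in> {k::int. x [^] k \<in> B}"
    then show "k - l \<in> {k::int. x [^] k \<in> B}"
      using x B by (simp add: int_pow_diff subgroup.m_closed subgroup.m_inv_closed)
  qed
  then obtain n :: int where n: "x [^] n \<in> B" "\<And>k::int. x [^] k \<in> B \<Longrightarrow> n dvd k" by auto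
  have nB: "x [^] k \<in> B" if "n dvd k" for k
  proof -
    obtain q where "k = n * q" using \<open>n dvd k\<close> by (auto simp: dvd_def)
    then have "x [^] k = (x [^] n) [^] q" using x by (simp add: int_pow_pow)
    then show ?thesis using subgroup_int_pow_closed[OF B n(1)] by simp
  qed
  \<comment> \<open>\<open>k\<close> represents the class modulo \<open>B\<close> of the
    \<open>C1\<close> component of \<open>a\<close>. It is determined modulo \<open>n\<close>, so
    \<open>f\<close> below represents a homomorphism to the integers modulo
    \<open>n\<close>.\<close>
  define P where "P a k \<longleftrightarrow> (\<exists>c d b. c \<in> C1 \<and> d \<in> ?D \<and> b \<in> B \<and> a = c \<otimes> d \<and> c = b \<otimes> x [^] k)" for a and k :: int
  have exP: "\<exists>k. P a k" if "a \<in> carrier G" for a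
    using ex[OF that] C1(1) unfolding P_def generate_insert_subgroup[OF B x] by blast
  define f where "f a = (SOME k. P a k)" for a
  have f: "P a (f a)" if "a \<in> carrier G" for a unfolding f_def by (rule someI_ex[OF exP[OF that]])
  have addP: "n dvd k'' - k - k'" if PP: "P a k" "P a' k'" "P (a \<otimes> a') k''" for a a' k k' k''
  proof -
    obtain c d b where 1: "c \<in> C1" "d \<in> ?D" "b \<in> B" "a = c \<otimes> d" "c = b \<otimes> x [^] k" using PP(1) P_def by auto
    obtain c' d' b' where 2: "c' \<in> C1" "d' \<in> ?D" "b' \<in> B" "a' = c' \<otimes> d'" "c' = b' \<otimes> x [^] k'" using PP(2) P_def by auto
    obtain c'' d'' b'' where 3: "c'' \<in> C1" "d'' \<in> ?D" "b'' \<in> B" "a \<otimes> a' = c'' \<otimes> d''" "c'' = b'' \<otimes> x [^] k''" using PP(3) P_def by auto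
    have car: "c \<in> carrier G" "c' \<in> carrier G" "d \<in> carrier G" "d' \<in> carrier G" "b \<in> carrier G" "b' \<in> carrier G" "b'' \<in> carrier G"
      using 1 2 3 C1c Dc Bc by auto
    have "(c \<otimes> c') \<otimes> (d \<otimes> d') = c'' \<otimes> d''" using 1(4) 2(4) 3(4) car by (simp add: m_ac)
    then have "c'' = c \<otimes> c'"
      using uniq(1)[of "c \<otimes> c'" c'' "d \<otimes> d'" d''] 1 2 3 C1(2) D by (simp add: subgroup.m_closed)
    then have e: "b'' \<otimes> x [^] k'' = (b \<otimes> b') \<otimes> x [^] (k + k')"
      using 1 2 3 car x by (simp add: int_pow_mult m_ac)
    have "x [^] (k'' - (k + k')) = inv b'' \<otimes> (b'' \<otimes> x [^] k'') \<otimes> inv (x [^] (k + k'))"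
      using car x by (simp add: int_pow_diff m_assoc[symmetric])
    also have "\<dots> = inv b'' \<otimes> (b \<otimes> b')" unfolding e using car x by (simp add: m_assoc)
    also have "\<dots> \<in> B" using 1 2 3 B by (simp add: subgroup.m_closed subgroup.m_inv_closed)
    finally show ?thesis using n(2) by (metis diff_diff_add)
  qed
  obtain h where hadd: "\<And>a b. a \<in> carrier G \<Longrightarrow> b \<in> carrier G \<Longrightarrow> h (a \<otimes> b) = h a + h b"
    and hf: "\<And>a. a \<in> carrier G \<Longrightarrow> n dvd h a - f a"
    using lift[of n f] addP f by (metis m_closed)
  have h1: "h \<one> = 0" using hadd[of \<one> \<one>] by simp
  have hinv: "h (inv a) = - h a" if "a \<in> carrier G" for a using hadd[of a "inv a"] that h1 by simp
  have hpn: "h (a [^] k) = int k * h a" if "a \<in> carrier G" for a and k :: nat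
    using that by (induction k) (auto simp: h1 hadd algebra_simps)
  have hp: "h (a [^] k) = k * h a" if "a \<in> carrier G" for a and k :: int
    using that by (cases k rule: int_cases2) (auto simp: hpn int_pow_int int_pow_neg_int hinv)
  \<comment> \<open>If \<open>h c = 0\<close>, then \<open>n\<close> divides \<open>f c\<close>, and
    \<open>x [^] f c\<close> lies in \<open>B\<close>; this is why \<open>C\<close> is contained in
    \<open>B\<close>.\<close>
  define C where "C = {c \<in> C1. h c = 0}"
  have C: "subgroup C G"
    by (rule subgroupI)
      (use C1c subgroup.one_closed[OF C1(2)] h1 hinv hadd C1(2) in \<open>auto simp: C_def subgroup.m_closed subgroup.m_inv_closed\<close>)
  have CB: "C \<subseteq> B"
  proof
    fix c assume c: "c \<in> C"
    then have c1: "c \<in> C1" "c \<in> carrier G" "h c = 0" using C1c by (auto simp: C_def)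
    obtain c' d b where cd: "c' \<in> C1" "d \<in> ?D" "b \<in> B" "c = c' \<otimes> d" "c' = b \<otimes> x [^] f c" using f[OF c1(2)] unfolding P_def by blast
    have "c = c'" using uniq(1)[OF c1(1) cd(1) subgroup.one_closed[OF D] cd(2)] cd(4) c1(2) by (metis r_one)
    moreover have "n dvd f c" using hf[OF c1(2)] c1(3) by simp
    ultimately show "c \<in> B" using subgroup.m_closed[OF B cd(3) nB] cd(5) by metis
  qed
  have "\<exists>e\<in>h ` C1. \<forall>k\<in>h ` C1. e dvd k"
  proof (rule int_diff_closed_principal)
    show "0 \<in> h ` C1" using h1 subgroup.one_closed[OF C1(2)] by force
    fix k l assume "k \<in> h ` C1" "l \<in> h ` C1"
    then obtain c d where "c \<in> C1" "d \<in> C1" "k = h c" "l = h d" by auto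
    then show "k - l \<in> h ` C1"
      using C1c C1(2) by (intro image_eqI[of _ _ "c \<otimes> inv d"]) (auto simp: hadd hinv subgroup.m_closed subgroup.m_inv_closed)
  qed
  then obtain c1 where c1: "c1 \<in> C1" "\<And>c. c \<in> C1 \<Longrightarrow> h c1 dvd h c" by auto
  \<comment> \<open>\<open>h c1\<close> generates the values of \<open>h\<close> on
    \<open>C1\<close>, so the powers of \<open>c0\<close> complement \<open>C\<close> in
    \<open>C1\<close>. If all these values are 0, then \<open>C\<close> is \<open>C1\<close> and
    \<open>c0\<close> has to be trivial.\<close>
  define c0 where "c0 = (if h c1 = 0 then \<one> else c1)"
  have c0: "c0 \<in> C1" "\<And>c. c \<in> C1 \<Longrightarrow> h c0 dvd h c" "h c0 = 0 \<Longrightarrow> c0 = \<one>"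
    using c1 subgroup.one_closed[OF C1(2)] h1 by (auto simp: c0_def)
  have c0c: "c0 \<in> carrier G" using c0 C1c by auto
  have c0p: "c0 [^] k \<in> C1" for k :: int using subgroup_int_pow_closed[OF C1(2) c0(1)] .
  let ?D' = "generate G (insert c0 Y)"
  have "?D' = generate G (insert c0 ?D)"
    using generate_Un_generate[of "{c0}" Y] c0c Y by simp
  also have "\<dots> = {d \<otimes> c0 [^] k | d k. d \<in> ?D \<and> (k::int) \<in> UNIV}" by (rule generate_insert_subgroup[OF D c0c])
  finally have D': "?D' = {d \<otimes> c0 [^] k | d k. d \<in> ?D \<and> (k::int) \<in> UNIV}" .
  have "C \<inter> ?D' = {\<one>}"
  proof
    show "C \<inter> ?D' \<subseteq> {\<one>}"
    proof
      fix c assume "c \<in> C \<inter> ?D'"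
      then obtain d k where c: "c \<in> C1" "h c = 0" "d \<in> ?D" "c = d \<otimes> c0 [^] (k::int)" unfolding D' by (auto simp: C_def)
      have car: "c \<in> carrier G" "d \<in> carrier G" using c C1c Dc by auto
      have "c \<otimes> \<one> = c0 [^] k \<otimes> d" using c(4) car c0c by (simp add: m_comm)
      then have ck: "c = c0 [^] k" using uniq(1)[of c "c0 [^] k" \<one> d] c c0p subgroup.one_closed[OF D] by blast
      then have "k * h c0 = 0" using hp[OF c0c] c(2) by simp
      then show "c \<in> {\<one>}" using ck c0(3) by auto
    qed
    show "{\<one>} \<subseteq> C \<inter> ?D'" using subgroup.one_closed[OF C] by (auto intro: generate.one)
  qed
  moreover have "C <#> ?D' = carrier G"
  proof
    have "?D' \<subseteq> carrier G" by (rule generate_incl) (use c0c Y in auto)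
    then show "C <#> ?D' \<subseteq> carrier G" using subgroup.mem_carrier[OF C] by (auto simp: set_mult_def)
    show "carrier G \<subseteq> C <#> ?D'"
    proof
      fix a assume "a \<in> carrier G"
      then obtain c d where cd: "c \<in> C1" "d \<in> ?D" "a = c \<otimes> d" using ex by blast
      obtain k where k: "h c = h c0 * k" using c0(2)[OF cd(1)] by (auto simp: dvd_def)
      have car: "c \<in> carrier G" "d \<in> carrier G" using cd C1c Dc by auto
      define u where "u = c \<otimes> inv (c0 [^] k)"
      have "u \<in> C1" using cd c0p C1(2) by (simp add: u_def subgroup.m_closed subgroup.m_inv_closed)
      moreover have "h u = 0" using car c0c k by (simp add: u_def hadd hinv hp mult.commute)
      ultimately have "u \<in> C" by (simp add: C_def)
      moreover have "d \<otimes> c0 [^] k \<in> ?D'" unfolding D' using cd by blast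
      moreover have "a = u \<otimes> (d \<otimes> c0 [^] k)"
      proof -
        have "u \<otimes> (d \<otimes> c0 [^] k) = c \<otimes> d \<otimes> (inv (c0 [^] k) \<otimes> c0 [^] k)"
          unfolding u_def using car c0c by (simp only: m_ac int_pow_closed inv_closed m_closed)
        then show ?thesis using cd car c0c by simp
      qed
      ultimately show "a \<in> C <#> ?D'" by (auto simp: set_mult_def)
    qed
  qed
  ultimately show ?case
    using C CB Y c0c by (intro exI[of _ C] exI[of _ "insert c0 Y"]) auto
qed

text \<open>A homomorphism to the integers modulo \<open>n\<close> is represented by an
  integer-valued \<open>f\<close> that is additive modulo \<open>n\<close>. Representatives of
  generators of the quotient generate the group together with \<open>B\<close>; the summand
  \<open>C\<close> found from them has a finitely generated complement, which maps onto the quotient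
  by \<open>C\<close>.\<close>

lemma coseparable_if_lifting:
  assumes "aleph1_free G"
    and lift: "\<And>(n::int) f. (\<And>a b. a \<in> carrier G \<Longrightarrow> b \<in> carrier G \<Longrightarrow> n dvd f (a \<otimes> b) - f a - f b) \<Longrightarrow>
      \<exists>h. (\<forall>a\<in>carrier G. \<forall>b\<in>carrier G. h (a \<otimes> b) = h a + h b) \<and> (\<forall>a\<in>carrier G. n dvd h a - f a)"
  shows "coseparable G"
  unfolding coseparable_def
proof (intro conjI allI impI)
  have quot: "group_hom G (G Mod C) (\<lambda>a. C #> a)" if "subgroup C G" for C
    using normal.r_coset_hom_Mod[OF subgroup_imp_normal[OF that]]
      normal.factorgroup_is_group[OF subgroup_imp_normal[OF that]]
    by (simp add: group_hom_def group_hom_axioms_def)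
  fix B assume "subgroup B G \<and> fin_generated (G Mod B)"
  then obtain Z where B: "subgroup B G" and Z: "Z \<subseteq> carrier (G Mod B)" "finite Z" "generate (G Mod B) Z = carrier (G Mod B)"
    by (auto simp: fin_generated_def)
  have Zi: "Z \<subseteq> (\<lambda>a. B #> a) ` carrier G" using Z(1) by (auto simp: FactGroup_def RCOSETS_def)
  obtain X where X: "X \<subseteq> carrier G" "finite X" "Z = (\<lambda>a. B #> a) ` X"
    using finite_subset_image[OF Z(2) Zi] by blast
  have gX: "generate (G Mod B) Z = (\<lambda>a. B #> a) ` generate G X"
    using group_hom.generate_img[OF quot[OF B] X(1)] X(3) by simp
  have BX: "B \<union> X \<subseteq> carrier G" using X subgroup.subset[OF B] by auto
  have "carrier G \<subseteq> generate G (B \<union> X)"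
  proof
    fix a assume a: "a \<in> carrier G"
    have "B #> a \<in> (\<lambda>a. B #> a) ` generate G X"
      unfolding gX[symmetric] Z(3) using a by (auto simp: FactGroup_def RCOSETS_def)
    then obtain d where d: "d \<in> generate G X" "B #> a = B #> d" by auto
    have "a \<in> B #> d" using rcos_self[OF a B] d by simp
    then obtain b where b: "b \<in> B" "a = b \<otimes> d" by (auto simp: r_coset_def)
    have "d \<in> generate G (B \<union> X)" using d mono_generate[of X "B \<union> X"] by auto
    then show "a \<in> generate G (B \<union> X)" unfolding b(2) using b(1) by (auto intro: generate.eng generate.incl)
  qed
  then have "generate G (B \<union> X) = carrier G" using generate_incl[OF BX] by auto
  then obtain C Y where CY: "C \<subseteq> B" "subgroup C G" "finite Y" "Y \<subseteq> carrier G" "C \<inter> generate G Y = {\<one>}"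
      "C <#> generate G Y = carrier G"
    using complement_inside_subgroup_of_finite_corank[OF lift X(2) X(1) B] by blast
  have "direct_summand C G" unfolding direct_summand_def using CY generate_is_subgroup[OF CY(4)] by blast
  moreover have "fin_generated (G Mod C)"
    unfolding fin_generated_def
  proof (intro exI conjI)
    show "(\<lambda>a. C #> a) ` Y \<subseteq> carrier (G Mod C)" using CY by (auto simp: FactGroup_def RCOSETS_def)
    show "finite ((\<lambda>a. C #> a) ` Y)" using CY by simp
    have "C #> a \<in> (\<lambda>a. C #> a) ` generate G Y" if a: "a \<in> carrier G" for a
    proof -
      obtain c d where cd: "c \<in> C" "d \<in> generate G Y" "a = c \<otimes> d" using a unfolding CY(6)[symmetric] by (auto simp: set_mult_def)
      have car: "c \<in> carrier G" "d \<in> carrier G"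
        using cd subgroup.mem_carrier[OF CY(2)] generate_in_carrier[OF CY(4)] by auto
      have "C #> a = (C #> c) #> d" using cd car subgroup.subset[OF CY(2)] by (simp add: coset_mult_assoc)
      also have "C #> c = C" using cd CY(2) by (simp add: coset_join2 car)
      finally show ?thesis using cd by blast
    qed
    then show "generate (G Mod C) ((\<lambda>a. C #> a) ` Y) = carrier (G Mod C)"
      unfolding group_hom.generate_img[OF quot[OF CY(2)] CY(4), symmetric]
      using generate_incl[OF CY(4)] group_hom.generate_img[OF quot[OF CY(2)] CY(4)]
      by (auto simp: FactGroup_def RCOSETS_def)
  qed
  ultimately show "\<exists>C\<subseteq>B. direct_summand C G \<and> fin_generated (G Mod C)" using CY(1) by blast
qed (rule assms(1))

end

section \<open>Choice of the relations\<close>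

text \<open>If \<open>c n\<close> is the value of a homomorphism at \<open>a n\<close>, then solutions \<open>v\<close> are the extensions of this
  homomorphism to elements \<open>y n\<close> subject to \<open>y n = (n + 1) y (n + 1) + a n\<close>.\<close>

definition solvable_chain :: "(nat \<Rightarrow> int) \<Rightarrow> bool" where
  "solvable_chain c \<longleftrightarrow> (\<exists>v. \<forall>n. v n = int (Suc n) * v (Suc n) + c n)"

text \<open>Each value is determined by the next one, so the tail \<open>t\<close> is continued
  downwards; \<open>d\<close> counts the steps below \<open>N\<close>.\<close>

lemma chain_solution_from_tail:
  fixes c t :: "nat \<Rightarrow> int"
  assumes "\<And>n. n \<ge> N \<Longrightarrow> t n = int (Suc n) * t (Suc n) + c n"
  shows "\<exists>v. (\<forall>n. v n = int (Suc n) * v (Suc n) + c n) \<and> (\<forall>n\<ge>N. v n = t n)"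
proof -
  have "\<exists>v. (\<forall>n\<ge>N - d. v n = int (Suc n) * v (Suc n) + c n) \<and> (\<forall>n\<ge>N. v n = t n)" for d
  proof (induction d)
    case 0
    show ?case by (intro exI[of _ t] conjI allI impI assms refl) simp
  next
    case (Suc d)
    then obtain v where v: "\<And>n. n \<ge> N - d \<Longrightarrow> v n = int (Suc n) * v (Suc n) + c n" "\<And>n. n \<ge> N \<Longrightarrow> v n = t n"
      by blast
    show ?case
    proof (cases "d < N")
      case True
      define m where "m = N - Suc d"
      have m: "Suc m = N - d" "m < N" using True by (auto simp: m_def)
      show ?thesis
      proof (intro exI[of _ "v(m := int (Suc m) * v (Suc m) + c m)"] conjI allI impI)
        fix n assume "N - Suc d \<le> n"
        then consider "n = m" | "n \<ge> N - d" using m by (fastforce simp: m_def)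
        then show "(v(m := int (Suc m) * v (Suc m) + c m)) n =
            int (Suc n) * (v(m := int (Suc m) * v (Suc m) + c m)) (Suc n) + c n"
          using v(1)[of n] m by cases auto
      qed (use m v(2) in auto)
    next
      case False
      then show ?thesis by (intro exI[of _ v] conjI allI impI v) auto
    qed
  qed
  from this[of N] show ?thesis by (metis diff_self_eq_0 le0)
qed

text \<open>The zero sequence solves the tail. In this way a lift extends to chains chosen after
  it.\<close>

lemma solvable_chain_if_eventually_zero:
  assumes "\<And>n. n \<ge> N \<Longrightarrow> c n = 0"
  shows "solvable_chain c"
  using chain_solution_from_tail[of N "\<lambda>_. 0" c] assms by (auto simp: solvable_chain_def)

text \<open>The disjointness in \<open>star_aleph0\<close>, stated for enumerations: an injective
  \<open>s i\<close> leaves a cofinite subset of its range only finitely often, so the sets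
  \<open>T i\<close> become tails starting at \<open>N i\<close>.\<close>

definition eventually_disjoint :: "('i \<Rightarrow> nat \<Rightarrow> 'a) \<Rightarrow> 'i set \<Rightarrow> bool" where
  "eventually_disjoint s I \<longleftrightarrow>
     (\<exists>N. \<forall>i\<in>I. \<forall>j\<in>I. \<forall>n\<ge>N i. \<forall>m\<ge>N j. s i n = s j m \<longrightarrow> i = j)"

text \<open>Finiteness of the rows is what makes the pigeonhole argument work for \<open>\<aleph>\<^sub>0\<close> too, where \<open>\<int>\<close> itself
  already has as many elements as a row.\<close>

definition finite_rows :: "'a set \<Rightarrow> ('a \<times> 'a \<Rightarrow> int) \<Rightarrow> bool" where
  "finite_rows R w \<longleftrightarrow> (\<forall>a\<in>R. finite ((\<lambda>x. w (a, x)) ` R))"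

text \<open>The pairs in \<open>R \<times> R\<close> index the basis of a free group, and \<open>a i n\<close> will be the difference of the basis
  elements at \<open>b i n\<close> and \<open>b' i n\<close> in row \<open>s i n\<close>. The last assumption says that a function modulo \<open>m\<close>
  lifts to an integer-valued one compatible with all chains as soon as it has such lifts, with finite
  rows, for every eventually disjoint set of chains.\<close>

locale twisted_family =
  fixes R :: "'a set" and \<Lambda> :: "'i set" and s b b' :: "'i \<Rightarrow> nat \<Rightarrow> 'a"
  assumes inj_s: "i \<in> \<Lambda> \<Longrightarrow> inj (s i)"
    and s_in: "i \<in> \<Lambda> \<Longrightarrow> s i n \<in> R"
    and b_in: "i \<in> \<Lambda> \<Longrightarrow> b i n \<in> R"
    and b'_in: "i \<in> \<Lambda> \<Longrightarrow> b' i n \<in> R"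
    and b_neq: "i \<in> \<Lambda> \<Longrightarrow> b i n \<noteq> b' i n"
    and countable_disjoint: "I \<subseteq> \<Lambda> \<Longrightarrow> countable I \<Longrightarrow> eventually_disjoint s I"
    and lifting: "(\<And>I. I \<subseteq> \<Lambda> \<Longrightarrow> eventually_disjoint s I \<Longrightarrow>
        \<exists>w. finite_rows R w \<and> (\<forall>x\<in>R \<times> R. (m::int) dvd w x - f x) \<and>
          (\<forall>k\<in>I. solvable_chain (\<lambda>n. w (s k n, b k n) - w (s k n, b' k n)))) \<Longrightarrow>
      \<exists>w. (\<forall>x\<in>R \<times> R. m dvd w x - f x) \<and>
          (\<forall>k\<in>\<Lambda>. solvable_chain (\<lambda>n. w (s k n, b k n) - w (s k n, b' k n)))"

section \<open>Cardinal arithmetic and the transfinite choice of the pairs\<close>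

lemma inj_on_imp_card_of_ordLeq:
  assumes "inj_on f A" "f ` A \<subseteq> B"
  shows "|A| \<le>o |B|"
  using assms card_of_ordLeq[of A B] by blast

lemma cofinality_omega_infinite_Field:
  assumes "has_cofinality r natLeq"
  shows "infinite (Field r)"
proof -
  obtain A where "A \<subseteq> Field r" "|A| =o natLeq" using assms by (auto simp: has_cofinality_def)
  then show ?thesis using ordIso_natLeq_infinite1 finite_subset by blast
qed

text \<open>An injection carries \<open>J\<close> into \<open>Field r\<close>, where it is cut along
  the initial segments below a countable cofinal set; each of these has fewer than \<open>r\<close>
  elements.\<close>

lemma cofinality_omega_decomposition:
  fixes r :: "'a rel" and J :: "'i set"
  assumes r: "Card_order r" and cf: "has_cofinality r natLeq" and J: "|J| \<le>o r"
  shows "\<exists>A::nat \<Rightarrow> 'i set. mono A \<and> J = (\<Union>n. A n) \<and> (\<forall>n. |A n| <o r)"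
proof -
  have inf: "infinite (Field r)" by (rule cofinality_omega_infinite_Field[OF cf])
  obtain C where C: "C \<subseteq> Field r" "cofinal C r" "|C| =o natLeq" using cf by (auto simp: has_cofinality_def)
  have "|UNIV :: nat set| =o |C|" by (rule ordIso_transitive[OF card_of_nat ordIso_symmetric[OF C(3)]])
  then obtain c :: "nat \<Rightarrow> 'a" where c: "range c = C" 
    using card_of_ordIso[of "UNIV :: nat set" C] bij_betw_imp_surj_on by metis
  have "|J| \<le>o |Field r|" by (rule ordLeq_ordIso_trans[OF J ordIso_symmetric[OF card_of_Field_ordIso[OF r]]])
  then obtain g where g: "inj_on g J" "g ` J \<subseteq> Field r"
    using card_of_ordLeq[of J "Field r"] by blast
  \<comment> \<open>The enumeration \<open>c\<close> need not be increasing; the finite unions make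
    \<open>A\<close> monotone and stay smaller than \<open>r\<close>.\<close>
  define U where "U n = (\<Union>m\<in>{..n::nat}. underS r (c m))" for n
  have U: "|U n| <o r" for n
  proof (induction n)
    case 0
    then show ?case using card_of_underS[OF r] c C(1) by (auto simp: U_def)
  next
    case (Suc n)
    have "U (Suc n) = underS r (c (Suc n)) \<union> U n" by (simp add: U_def atMost_Suc)
    moreover have "|underS r (c (Suc n))| <o r" using card_of_underS[OF r] c C(1) by blast
    ultimately show ?case using card_of_Un_ordLess_infinite_Field[OF inf r _ Suc] by simp
  qed
  define A where "A n = {j \<in> J. g j \<in> U n}" for n
  have "|A n| \<le>o |U n|" for n
  proof -
    have "inj_on g (A n)" "g ` A n \<subseteq> U n" using g by (auto simp: A_def inj_on_def)
    then show ?thesis by (rule inj_on_imp_card_of_ordLeq)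
  qed
  then have "|A n| <o r" for n by (rule ordLeq_ordLess_trans[OF _ U])
  moreover have "mono A" by (rule monoI) (force simp: A_def U_def)
  moreover have "J = (\<Union>n. A n)"
  proof
    show "J \<subseteq> (\<Union>n. A n)"
    proof
      fix j assume j: "j \<in> J"
      then have "g j \<in> Field r" using g by auto
      then obtain y where "y \<in> C" "g j \<noteq> y" "(g j, y) \<in> r" using C(2) by (auto simp: cofinal_def)
      then obtain n where "g j \<in> underS r (c n)" using c by (auto simp: underS_def)
      then have "g j \<in> U n" by (auto simp: U_def)
      then show "j \<in> (\<Union>n. A n)" using j by (auto simp: A_def)
    qed
  qed (auto simp: A_def)
  ultimately show ?thesis by blast
qed

text \<open>The values \<open>W j x\<close> for \<open>j\<close> in \<open>A\<close> are recorded by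
  a subset \<open>?G x\<close> of \<open>Z\<close>. There are fewer than \<open>r\<close> such
  subsets, so two points share one.\<close>

lemma strong_limit_pigeonhole:
  fixes r :: "'a rel" and W :: "'i \<Rightarrow> 'a \<Rightarrow> int"
  assumes r: "Card_order r" and inf: "infinite (Field r)"
    and sl: "\<forall>mu :: 'a rel. Card_order mu \<and> mu <o r \<longrightarrow> ctwo ^c mu <o r"
    and A: "|A| <o r" and fin: "\<And>j. j \<in> A \<Longrightarrow> finite (W j ` Field r)"
  shows "\<exists>x\<in>Field r. \<exists>y\<in>Field r. x \<noteq> y \<and> (\<forall>j\<in>A. W j x = W j y)"
proof (rule ccontr)
  assume neg: "\<not> ?thesis"
  have rF: "|Field r| =o r" by (rule card_of_Field_ordIso[OF r])
  \<comment> \<open>Since the rows are finite, \<open>Z\<close> is finite or no larger than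
    \<open>A\<close>.\<close>
  define Z where "Z = (SIGMA j:A. W j ` Field r)"
  have Z: "|Z| <o r"
  proof (cases "finite A")
    case True
    then have "finite Z" using fin by (auto simp: Z_def)
    then have "|Z| <o |Field r|" using inf by simp
    then show ?thesis by (rule ordLess_ordIso_trans[OF _ rF])
  next
    case False
    have "\<forall>j\<in>A. |W j ` Field r| \<le>o |A|"
      using fin False finite_ordLess_infinite2 ordLess_imp_ordLeq by blast
    then have "|Z| \<le>o |A|" unfolding Z_def
      by (intro card_of_Sigma_ordLeq_infinite[OF False]) auto
    then show ?thesis by (rule ordLeq_ordLess_trans[OF _ A])
  qed
  then have "|Z| \<le>o |Field r|" by (rule ordLeq_ordIso_trans[OF ordLess_imp_ordLeq ordIso_symmetric[OF rF]])
  \<comment> \<open>The hypothesis \<open>sl\<close> concerns cardinals on the type of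
    \<open>r\<close>, so \<open>Z\<close> is copied into \<open>Field r\<close>.\<close>
  then obtain g where g: "inj_on g Z" "g ` Z \<subseteq> Field r"
    using card_of_ordLeq[of Z "Field r"] by blast
  then have ZQ: "|Z| =o |g ` Z|"
    using card_of_ordIso[of Z "g ` Z"] bij_betw_imageI[OF g(1) refl] by blast
  have "|g ` Z| <o r" by (rule ordIso_ordLess_trans[OF ordIso_symmetric[OF ZQ] Z])
  then have "ctwo ^c |g ` Z| <o r" using sl card_of_Card_order by blast
  then have "|Pow (g ` Z)| <o r" by (rule ordIso_ordLess_trans[OF Pow_cexp_ctwo])
  then have PZ: "|Pow Z| <o r" by (rule ordLeq_ordLess_trans[OF card_of_Pow_mono[OF ordIso_imp_ordLeq[OF ZQ]]])
  let ?G = "\<lambda>x. (\<lambda>j. (j, W j x)) ` A"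
  have "inj_on ?G (Field r)"
  proof (rule inj_onI)
    fix x y assume xy: "x \<in> Field r" "y \<in> Field r" "?G x = ?G y"
    have "W j x = W j y" if "j \<in> A" for j
    proof -
      have "(j, W j x) \<in> ?G y" using that unfolding xy(3)[symmetric] by auto
      then show ?thesis by auto
    qed
    then show "x = y" using neg xy by blast
  qed
  moreover have "?G ` Field r \<subseteq> Pow Z" by (auto simp: Z_def)
  ultimately have "|Field r| \<le>o |Pow Z|" by (rule inj_on_imp_card_of_ordLeq)
  then have "r \<le>o |Pow Z|" by (rule ordIso_ordLeq_trans[OF ordIso_symmetric[OF rF]])
  then show False using PZ not_ordLess_ordLeq by blast
qed

text \<open>A modulus and the graph of a function are coded together as a subset of a set of size at
  most \<open>lam\<close>, and that set has at most \<open>ctwo ^c lam\<close> subsets.\<close>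

lemma functions_enumeration:
  fixes lam :: "'a rel"
  assumes r: "Card_order lam" and inf: "infinite (Field lam)" and exp: "ctwo ^c lam =o cardSuc lam"
  shows "\<exists>e :: 'a set \<Rightarrow> int \<times> ('a \<times> 'a \<Rightarrow> int).
     \<forall>m f. \<exists>i\<in>Field (cardSuc lam). fst (e i) = m \<and> (\<forall>x\<in>Field lam \<times> Field lam. snd (e i) x = f x)"
proof -
  let ?R = "Field lam" and ?L = "Field (cardSuc lam)"
  let ?X = "?R \<times> ?R"
  have rF: "|?R| =o lam" by (rule card_of_Field_ordIso[OF r])
  have cI: "|UNIV :: int set| \<le>o |?R|"
    using inf infinite_iff_card_of_countable[of "UNIV :: int set" ?R] by (simp add: infinite_UNIV_int)
  have "|?X \<times> (UNIV::int set)| \<le>o |?R|"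
    by (intro card_of_Times_ordLeq_infinite[OF inf] cI card_of_refl ordIso_imp_ordLeq)
  then have "|UNIV <+> ?X \<times> (UNIV::int set) :: (int + ('a \<times> 'a) \<times> int) set| \<le>o |?R|"
    using card_of_Plus_ordLeq_infinite[OF inf cI] by blast
  then have "|Pow (UNIV <+> ?X \<times> (UNIV::int set) :: (int + ('a \<times> 'a) \<times> int) set)| \<le>o |Pow ?R|" by simp
  moreover have "|Pow ?R| =o cardSuc lam"
    by (rule ordIso_transitive[OF Pow_cexp_ctwo
          ordIso_transitive[OF cexp_cong2[OF rF Card_order_ctwo card_of_Card_order] exp]])
  moreover have "cardSuc lam =o |?L|" by (rule ordIso_symmetric[OF card_of_Field_ordIso[OF cardSuc_Card_order[OF r]]])
  ultimately have P: "|Pow (UNIV <+> ?X \<times> (UNIV::int set) :: (int + ('a \<times> 'a) \<times> int) set)| \<le>o |?L|"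
    by (metis ordLeq_ordIso_trans)
  let ?F = "(UNIV :: int set) \<times> Func ?X (UNIV :: int set)"
  let ?g = "\<lambda>(m, f). insert (Inl m) ((\<lambda>x. Inr (x, f x)) ` ?X) :: (int + ('a \<times> 'a) \<times> int) set"
  have "inj_on ?g ?F"
  proof (rule inj_onI)
    fix p q assume p: "p \<in> ?F" and q: "q \<in> ?F" and "?g p = ?g q"
    obtain m f m' f' where pq: "p = (m, f)" "q = (m', f')" by (metis surj_pair)
    have e: "insert (Inl m) ((\<lambda>x. Inr (x, f x)) ` ?X) = insert (Inl m') ((\<lambda>x. Inr (x, f' x)) ` ?X)"
      using \<open>?g p = ?g q\<close> pq by simp
    have "Inl m \<in> insert (Inl m') ((\<lambda>x. Inr (x, f' x)) ` ?X)" unfolding e[symmetric] by simp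
    then have "m = m'" by auto
    have "f x = f' x" if "x \<in> ?X" for x
    proof -
      have "Inr (x, f x) \<in> insert (Inl m') ((\<lambda>x. Inr (x, f' x)) ` ?X)" unfolding e[symmetric] using that by blast
      then show ?thesis by auto
    qed
    moreover have "f x = undefined" "f' x = undefined" if "x \<notin> ?X" for x
    proof -
      have "f \<in> Func ?X UNIV" "f' \<in> Func ?X UNIV" using p q pq by auto
      then show "f x = undefined" "f' x = undefined" using that unfolding Func_def by blast+
    qed
    ultimately have "f = f'" by (metis ext)
    then show "p = q" using pq \<open>m = m'\<close> by simp
  qed
  moreover have "?g ` ?F \<subseteq> Pow (UNIV <+> ?X \<times> UNIV)" by auto
  ultimately have "|?F| \<le>o |Pow (UNIV <+> ?X \<times> (UNIV::int set) :: (int + ('a \<times> 'a) \<times> int) set)|"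
    by (rule inj_on_imp_card_of_ordLeq)
  then have "|?F| \<le>o |?L|" by (rule ordLeq_transitive[OF _ P])
  moreover have "?F \<noteq> {}" by (auto simp: Func_non_emp)
  ultimately obtain e where e: "e ` ?L = ?F" using card_of_ordLeq2[of ?F ?L] by blast
  show ?thesis
  proof (intro exI[of _ e] allI)
    fix m and f :: "'a \<times> 'a \<Rightarrow> int"
    \<comment> \<open>Members of \<open>Func\<close> are \<open>undefined\<close> off the domain, so
      \<open>f\<close> is normalised before it is looked up.\<close>
    let ?f = "\<lambda>x. if x \<in> ?X then f x else undefined"
    have "(m, ?f) \<in> ?F" by (auto simp: Func_def)
    then obtain i where "i \<in> ?L" "e i = (m, ?f)" using e by (metis (no_types, lifting) image_iff)
    then show "\<exists>i\<in>?L. fst (e i) = m \<and> (\<forall>x\<in>?X. snd (e i) x = f x)" by (intro bexI[of _ i]) auto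
  qed
qed

text \<open>\<open>star_aleph0\<close> speaks of index sets of cardinality exactly
  \<open>lam\<close>; smaller ones are enlarged before it is applied.\<close>

lemma subset_extend_to_card:
  assumes r: "Card_order r" and inf: "infinite (Field r)" and I: "I \<subseteq> Field (cardSuc r)" "|I| \<le>o r"
  shows "\<exists>I'. I \<subseteq> I' \<and> I' \<subseteq> Field (cardSuc r) \<and> |I'| =o r"
proof -
  have rF: "|Field r| =o r" by (rule card_of_Field_ordIso[OF r])
  have "r \<le>o |Field (cardSuc r)|"
    by (rule ordLeq_ordIso_trans[OF cardSuc_ordLeq[OF r] ordIso_symmetric[OF card_of_Field_ordIso[OF cardSuc_Card_order[OF r]]]])
  then have "|Field r| \<le>o |Field (cardSuc r)|" by (rule ordIso_ordLeq_trans[OF rF])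
  then obtain g where g: "inj_on g (Field r)" "g ` Field r \<subseteq> Field (cardSuc r)"
    using card_of_ordLeq[of "Field r" "Field (cardSuc r)"] by blast
  have "|g ` Field r| \<le>o r" by (rule ordLeq_ordIso_trans[OF card_of_image rF])
  then have le: "|I \<union> g ` Field r| \<le>o r" by (rule card_of_Un_ordLeq_infinite_Field[OF inf I(2) _ r])
  have "|Field r| \<le>o |I \<union> g ` Field r|" by (rule inj_on_imp_card_of_ordLeq[OF g(1)]) simp
  then have "r \<le>o |I \<union> g ` Field r|" by (rule ordIso_ordLeq_trans[OF ordIso_symmetric[OF rF]])
  then have "|I \<union> g ` Field r| =o r" using le by (simp add: ordIso_iff_ordLeq)
  then show ?thesis using I g by (intro exI[of _ "I \<union> g ` Field r"]) auto
qed

text \<open>As \<open>s i\<close> is injective, only finitely many \<open>n\<close> have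
  \<open>s i n\<close> in the finite set \<open>S i - T i\<close>.\<close>

lemma eventually_disjoint_if_star_family:
  assumes r: "Card_order lam" and inf: "infinite (Field lam)"
    and star: "\<forall>I\<subseteq>Field (cardSuc lam). |I| =o lam \<longrightarrow>
        (\<exists>T. (\<forall>i\<in>I. finite (S i - T i)) \<and> (\<forall>i\<in>I. \<forall>j\<in>I. i \<noteq> j \<longrightarrow> T i \<inter> T j = {}))"
    and inj: "\<And>i. i \<in> Field (cardSuc lam) \<Longrightarrow> inj (s i :: nat \<Rightarrow> 'a)"
    and rng: "\<And>i. i \<in> Field (cardSuc lam) \<Longrightarrow> range (s i) = S i"
    and I: "I \<subseteq> Field (cardSuc lam)" "|I| \<le>o lam"
  shows "eventually_disjoint s I"
proof -
  obtain I' where I': "I \<subseteq> I'" "I' \<subseteq> Field (cardSuc lam)" "|I'| =o lam"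
    using subset_extend_to_card[OF r inf I] by blast
  obtain T where T0: "(\<forall>i\<in>I'. finite (S i - T i)) \<and> (\<forall>i\<in>I'. \<forall>j\<in>I'. i \<noteq> j \<longrightarrow> T i \<inter> T j = {})"
    using star[rule_format, OF I'(2,3)] by (rule exE)
  note T = conjunct1[OF T0, rule_format] conjunct2[OF T0, rule_format]
  have "\<exists>N. \<forall>n\<ge>N. s i n \<in> T i" if i: "i \<in> I" for i
  proof -
    have "s i ` {n. s i n \<notin> T i} \<subseteq> S i - T i" using rng[of i] i I by auto
    then have "finite (s i ` {n. s i n \<notin> T i})" using T(1)[of i] i I' finite_subset by blast
    then have "finite {n. s i n \<notin> T i}"
      using finite_imageD inj_on_subset[OF inj[of i] subset_UNIV] i I by blast
    then obtain N where "\<forall>n\<in>{n. s i n \<notin> T i}. n < N" using finite_nat_set_iff_bounded by blast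
    then show ?thesis by (intro exI[of _ N]) (auto simp: not_less[symmetric])
  qed
  then obtain N where N: "\<And>i n. i \<in> I \<Longrightarrow> n \<ge> N i \<Longrightarrow> s i n \<in> T i" by metis
  show ?thesis unfolding eventually_disjoint_def
  proof (intro exI[of _ N] ballI allI impI)
    fix i j n m assume a: "i \<in> I" "j \<in> I" "N i \<le> n" "N j \<le> m" "s i n = s j m"
    then have "s i n \<in> T i \<inter> T j" using N[of i n] N[of j m] by auto
    then show "i = j" using T(2)[of i j] a I' by blast
  qed
qed

text \<open>The pairs are chosen by recursion along \<open>cardSuc lam\<close>. A function modulo
  \<open>m\<close> that has to be lifted is the \<open>i\<close>-th one for some \<open>i\<close>;
  its lift \<open>W c i\<close> solves the chains below \<open>i\<close> by construction, and the
  chains from \<open>i\<close> on because their pairs respect it.\<close>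

theorem twisted_family_exists:
  fixes lam :: "'a rel"
  assumes r: "Card_order lam" and cf: "has_cofinality lam natLeq" and exp: "ctwo ^c lam =o cardSuc lam"
    and sl: "\<forall>mu :: 'a rel. Card_order mu \<and> mu <o lam \<longrightarrow> ctwo ^c mu <o lam"
    and star: "star_aleph0 lam"
  shows "\<exists>s b b'. twisted_family (Field lam) (Field (cardSuc lam)) s b b'"
proof -
  let ?R = "Field lam" and ?L = "Field (cardSuc lam)"
  let ?q = "cardSuc lam"
  have inf: "infinite ?R" by (rule cofinality_omega_infinite_Field[OF cf])
  have q: "Well_order ?q" by (rule cardSuc_Well_order[OF r])
  then have re: "refl_on ?L ?q" and tot: "total_on ?L ?q" and tr: "trans ?q" and an: "antisym ?q" and wf: "wf (?q - Id)"
    by (auto simp: well_order_on_def linear_order_on_def partial_order_on_def preorder_on_def)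
  obtain S where S0: "(\<forall>i\<in>?L. S i \<subseteq> ?R \<and> countable (S i) \<and> infinite (S i)) \<and>
      (\<forall>I\<subseteq>?L. |I| =o lam \<longrightarrow> (\<exists>T. (\<forall>i\<in>I. finite (S i - T i)) \<and>
        (\<forall>i\<in>I. \<forall>j\<in>I. i \<noteq> j \<longrightarrow> T i \<inter> T j = {})))"
    using star unfolding star_aleph0_def by (rule exE)
  have S: "S i \<subseteq> ?R \<and> countable (S i) \<and> infinite (S i)" if "i \<in> ?L" for i
    using conjunct1[OF S0] that by (rule bspec)
  note ST = conjunct2[OF S0]
  define s where "s i = from_nat_into (S i)" for i
  have s: "inj (s i)" "range (s i) = S i" if "i \<in> ?L" for i
    using S[OF that] bij_betw_from_nat_into[of "S i"] by (auto simp: s_def bij_betw_def)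
  have sR: "s i n \<in> ?R" if "i \<in> ?L" for i n using s(2)[OF that] S[OF that] by auto
  have dis: "eventually_disjoint s I" if "I \<subseteq> ?L" "|I| \<le>o lam" for I
    by (rule eventually_disjoint_if_star_family[OF r inf ST s that])
  obtain e :: "'a set \<Rightarrow> int \<times> ('a \<times> 'a \<Rightarrow> int)"
    where e: "\<And>m f. \<exists>i\<in>?L. fst (e i) = m \<and> (\<forall>x\<in>?R \<times> ?R. snd (e i) x = f x)"
    using functions_enumeration[OF r inf exp] by blast
  \<comment> \<open>\<open>e\<close> enumerates the functions to be lifted; \<open>W c i\<close> is a lift of the \<open>i\<close>-th one over the chains below
    \<open>i\<close>, and the pairs \<open>c i\<close> are chosen so that all \<open>W c j\<close> with \<open>j \<le> i\<close> are eventually constant on them.\<close>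
  define good where "good c i w \<longleftrightarrow> finite_rows ?R w \<and> (\<forall>x\<in>?R \<times> ?R. fst (e i) dvd w x - snd (e i) x) \<and>
      (\<forall>k\<in>underS ?q i. solvable_chain (\<lambda>n. w (s k n, fst (c k n)) - w (s k n, snd (c k n))))"
    for c :: "'a set \<Rightarrow> nat \<Rightarrow> 'a \<times> 'a" and i w
  \<comment> \<open>The default 0 has finite rows, so the pigeonhole argument covers indices without
    a lift as well.\<close>
  define W where "W c i = (if \<exists>w. good c i w then SOME w. good c i w else (\<lambda>_. 0))" for c i
  have W: "good c i (W c i)" if "good c i w" for c i w
    using that someI[of "good c i" w] by (auto simp: W_def)
  have W_rows: "finite_rows ?R (W c i)" for c i
  proof (cases "\<exists>w. good c i w")
    case True
    then show ?thesis using W by (auto simp: good_def)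
  qed (auto simp: W_def finite_rows_def image_constant_conv)
  \<comment> \<open>The recursion requires that \<open>W c i\<close> depend only on the pairs chosen
    below \<open>i\<close>.\<close>
  have W_cong: "W c i = W d i" if "\<And>k. k \<in> underS ?q i \<Longrightarrow> c k = d k" for c d i
  proof -
    have "good c i = good d i" using that by (auto simp: good_def fun_eq_iff)
    then show ?thesis by (simp add: W_def)
  qed
  \<comment> \<open>\<open>under\<close> contains \<open>i\<close> although \<open>good\<close> uses
    \<open>underS\<close>: the pairs at \<open>i\<close> are chosen after \<open>W c i\<close> and
    must respect it too.\<close>
  define P where "P c i p \<longleftrightarrow> (i \<in> ?L \<longrightarrow>
      (\<forall>n. fst (p n) \<in> ?R \<and> snd (p n) \<in> ?R \<and> fst (p n) \<noteq> snd (p n)) \<and>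
      (\<forall>j\<in>under ?q i. \<exists>N. \<forall>n\<ge>N. W c j (s i n, fst (p n)) = W c j (s i n, snd (p n))))"
    for c :: "'a set \<Rightarrow> nat \<Rightarrow> 'a \<times> 'a" and i and p :: "nat \<Rightarrow> 'a \<times> 'a"
  have "\<exists>c. \<forall>i. P c i (c i)"
  proof (rule dependent_wf_choice[OF wf])
    fix c d :: "'a set \<Rightarrow> nat \<Rightarrow> 'a \<times> 'a" and i p assume cd: "\<And>z. (z, i) \<in> ?q - Id \<Longrightarrow> c z = d z"
    have "W c j = W d j" if j: "j \<in> under ?q i" for j
    proof (rule W_cong)
      fix k assume "k \<in> underS ?q j"
      then have kj: "(k, j) \<in> ?q" "k \<noteq> j" and ji: "(j, i) \<in> ?q" using j by (auto simp: underS_def under_def)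
      then have "(k, i) \<in> ?q" "k \<noteq> i" using tr an by (auto dest: transD antisymD)
      then show "c k = d k" using cd by blast
    qed
    then show "P c i p = P d i p" by (auto simp: P_def)
  next
    fix i and c :: "'a set \<Rightarrow> nat \<Rightarrow> 'a \<times> 'a"
    show "\<exists>p. P c i p"
    proof (cases "i \<in> ?L")
      case iL: True
      have "|underS ?q i| <o ?q" by (rule card_of_underS[OF cardSuc_Card_order[OF r] iL])
      then have "|underS ?q i| \<le>o lam" using cardSuc_ordLeq_ordLess[OF r card_of_Card_order] by blast
      moreover have "|{i}| \<le>o lam"
        by (rule ordLeq_ordIso_trans[OF ordLess_imp_ordLeq[OF finite_ordLess_infinite2[OF _ inf]] card_of_Field_ordIso[OF r]]) simp
      ultimately have un: "|underS ?q i \<union> {i}| \<le>o lam" by (rule card_of_Un_ordLeq_infinite_Field[OF inf _ _ r])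
      have "under ?q i \<subseteq> underS ?q i \<union> {i}" by (auto simp: under_def underS_def)
      then have "|under ?q i| \<le>o lam" by (rule ordLeq_transitive[OF card_of_mono1 un])
      \<comment> \<open>At position \<open>n\<close> only the lifts in \<open>A n\<close> are
        matched. As \<open>A\<close> increases to \<open>under ?q i\<close>, each lift is matched
        from some position on.\<close>
      then obtain A :: "nat \<Rightarrow> 'a set set" where A: "mono A" "under ?q i = (\<Union>n. A n)" "\<And>n. |A n| <o lam"
        using cofinality_omega_decomposition[OF r cf] by blast
      have "\<exists>x\<in>?R. \<exists>y\<in>?R. x \<noteq> y \<and> (\<forall>j\<in>A n. W c j (s i n, x) = W c j (s i n, y))" for n
      proof (rule strong_limit_pigeonhole[OF r inf sl A(3)])
        fix j show "finite ((\<lambda>x. W c j (s i n, x)) ` ?R)"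
          using W_rows[of c j] sR[OF iL] by (auto simp: finite_rows_def)
      qed
      then obtain x y where xy: "\<And>n. x n \<in> ?R" "\<And>n. y n \<in> ?R" "\<And>n. x n \<noteq> y n"
        "\<And>n j. j \<in> A n \<Longrightarrow> W c j (s i n, x n) = W c j (s i n, y n)" by metis
      have "P c i (\<lambda>n. (x n, y n))"
        unfolding P_def
      proof (intro impI conjI allI ballI)
        fix j assume "j \<in> under ?q i"
        then obtain N where "j \<in> A N" using A(2) by auto
        then have "j \<in> A n" if "n \<ge> N" for n using that A(1) by (auto dest: monoD)
        then show "\<exists>N. \<forall>n\<ge>N. W c j (s i n, fst (x n, y n)) = W c j (s i n, snd (x n, y n))"
          using xy(4) by auto
      qed (use xy in auto)
      then show ?thesis by blast
    qed (auto simp: P_def)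
  qed
  then obtain c where c: "\<And>i. P c i (c i)" by blast
  show ?thesis
  proof (intro exI, unfold_locales)
    fix i assume i: "i \<in> ?L"
    show "inj (s i)" by (rule s(1)[OF i])
    fix n
    show "s i n \<in> ?R" by (rule sR[OF i])
    show "fst (c i n) \<in> ?R" "snd (c i n) \<in> ?R" "fst (c i n) \<noteq> snd (c i n)"
      using c[of i] i by (auto simp: P_def)
  next
    fix I assume I: "I \<subseteq> ?L" "countable I"
    then obtain g :: "'a set \<Rightarrow> nat" where "inj_on g I" by (auto simp: countable_def)
    then have "|I| \<le>o |UNIV :: nat set|" by (rule inj_on_imp_card_of_ordLeq) simp
    moreover have "|UNIV :: nat set| \<le>o |?R|" using inf infinite_iff_card_of_nat by blast
    ultimately have "|I| \<le>o |?R|" by (rule ordLeq_transitive)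
    then show "eventually_disjoint s I"
      using dis[OF I(1) ordLeq_ordIso_trans] card_of_Field_ordIso[OF r] by blast
  next
    fix m f
    assume *: "\<And>I. I \<subseteq> ?L \<Longrightarrow> eventually_disjoint s I \<Longrightarrow>
        \<exists>w. finite_rows ?R w \<and> (\<forall>x\<in>?R \<times> ?R. m dvd w x - f x) \<and>
          (\<forall>k\<in>I. solvable_chain (\<lambda>n. w (s k n, fst (c k n)) - w (s k n, snd (c k n))))"
    obtain i where i: "i \<in> ?L" "fst (e i) = m" "\<And>x. x \<in> ?R \<times> ?R \<Longrightarrow> snd (e i) x = f x" using e by metis
    have uL: "underS ?q i \<subseteq> ?L" by (auto simp: underS_def Field_def)
    have "|underS ?q i| <o ?q" by (rule card_of_underS[OF cardSuc_Card_order[OF r] i(1)])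
    then have "|underS ?q i| \<le>o lam" using cardSuc_ordLeq_ordLess[OF r card_of_Card_order] by blast
    \<comment> \<open>At most \<open>lam\<close> chains lie below \<open>i\<close>, so they are
      eventually disjoint and the assumption supplies a lift over them.\<close>
    then obtain w where "good c i w"
      using *[OF uL dis[OF uL]] i by (auto simp: good_def)
    then have g: "good c i (W c i)" by (rule W)
    show "\<exists>w. (\<forall>x\<in>?R \<times> ?R. m dvd w x - f x) \<and>
          (\<forall>k\<in>?L. solvable_chain (\<lambda>n. w (s k n, fst (c k n)) - w (s k n, snd (c k n))))"
    proof (intro exI[of _ "W c i"] conjI ballI)
      show "m dvd W c i x - f x" if "x \<in> ?R \<times> ?R" for x using g i that by (auto simp: good_def)
      fix k assume k: "k \<in> ?L"
      show "solvable_chain (\<lambda>n. W c i (s k n, fst (c k n)) - W c i (s k n, snd (c k n)))"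
      proof (cases "k \<in> underS ?q i")
        case True
        then show ?thesis using g by (simp add: good_def)
      next
        case False
        then have "(k, i) \<notin> ?q \<or> k = i" by (auto simp: underS_def)
        then have "i \<in> under ?q k"
          using refl_onD[OF re k] tot[unfolded total_on_def, rule_format, OF k i(1)]
          by (cases "k = i") (auto simp: under_def)
        then obtain N where "\<forall>n\<ge>N. W c i (s k n, fst (c k n)) = W c i (s k n, snd (c k n))"
          using c[of k] k by (auto simp: P_def)
        then show ?thesis by (intro solvable_chain_if_eventually_zero[of N]) auto
      qed
    qed
  qed
qed

section \<open>The group defined by the relations\<close>

lemma group_closure_mono:
  assumes "S \<subseteq> T"
  shows "group_closure S \<subseteq> group_closure T"
proof
  fix x assume "x \<in> group_closure S"
  then show "x \<in> group_closure T"
    by induction (use assms in \<open>auto intro: group_closure.intros\<close>)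
qed

lemma group_closure_least:
  assumes "S \<subseteq> group_closure T"
  shows "group_closure S \<subseteq> group_closure T"
proof
  fix x assume "x \<in> group_closure S"
  then show "x \<in> group_closure T"
    by induction (use assms in \<open>auto intro: group_closure.intros\<close>)
qed

text \<open>Turns a set in an additive type-class group into a group record, so that
  \<open>group_closure\<close> can be combined with the algebra of records.\<close>

definition additive_group :: "'v::ab_group_add set \<Rightarrow> 'v monoid" where
  "additive_group A = \<lparr>carrier = A, monoid.mult = (+), one = 0\<rparr>"

lemma additive_group_simps [simp]:
  "carrier (additive_group A) = A" "x \<otimes>\<^bsub>additive_group A\<^esub> y = x + y" "\<one>\<^bsub>additive_group A\<^esub> = 0"
  by (auto simp: additive_group_def)

lemma comm_group_additive_group: "comm_group (additive_group (group_closure S))"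
proof (rule comm_groupI)
  fix x assume "x \<in> carrier (additive_group (group_closure S))"
  then show "\<exists>y\<in>carrier (additive_group (group_closure S)). y \<otimes>\<^bsub>additive_group (group_closure S)\<^esub> x = \<one>\<^bsub>additive_group (group_closure S)\<^esub>"
    by (intro bexI[of _ "- x"]) auto
qed (auto intro: group_closure_add simp: algebra_simps)

text \<open>The functional that is 1 at \<open>c\<close> and 0 on the rest of \<open>B\<close> reads
  off the coefficient of \<open>c\<close>. Hence the natural map \<open>h\<close> from the free
  group on \<open>B\<close> is injective, and its inverse is the embedding.\<close>

lemma group_closure_embeds_free:
  fixes B :: "'v::ab_group_add set"
  assumes dual: "\<And>c. c \<in> B \<Longrightarrow> \<exists>\<phi> :: 'v \<Rightarrow> rat. (\<forall>g h. \<phi> (g - h) = \<phi> g - \<phi> h) \<and> \<phi> c = 1 \<and> (\<forall>c'\<in>B - {c}. \<phi> c' = 0)"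
  shows "\<exists>\<theta>. \<theta> \<in> hom (additive_group (group_closure B)) (free_Abelian_group B) \<and> inj_on \<theta> (group_closure B)"
proof -
  let ?A = "additive_group (group_closure B)"
  interpret A: comm_group ?A by (rule comm_group_additive_group)
  obtain h where h: "h \<in> hom (free_Abelian_group B) ?A" and hB: "\<And>c. c \<in> B \<Longrightarrow> h (frag_of c) = c"
    using A.free_Abelian_group_universal[of "\<lambda>c. c" B] by (auto intro: group_closure.base)
  interpret h: group_hom "free_Abelian_group B" ?A h
    using h by (simp add: group_hom_def group_hom_axioms_def)
  have hadd: "h (u + v) = h u + h v" if "Poly_Mapping.keys u \<subseteq> B" "Poly_Mapping.keys v \<subseteq> B" for u v
    using h.hom_mult[of u v] that by simp
  have hdiff: "h (u - v) = h u - h v" if "Poly_Mapping.keys u \<subseteq> B" "Poly_Mapping.keys v \<subseteq> B" for u v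
  proof -
    have "Poly_Mapping.keys (u - v) \<subseteq> B" using that keys_diff[of u v] by blast
    then show ?thesis using hadd[of "u - v" v] that by (simp add: algebra_simps)
  qed
  have h0: "h 0 = 0" using h.hom_one by simp
  have inj: "u = 0" if u: "Poly_Mapping.keys u \<subseteq> B" "h u = 0" for u
  proof (rule poly_mapping_eqI)
    fix c
    show "Poly_Mapping.lookup u c = Poly_Mapping.lookup 0 c"
    proof (cases "c \<in> B")
      case True
      obtain \<phi> :: "'v \<Rightarrow> rat" where \<phi>: "\<And>g h. \<phi> (g - h) = \<phi> g - \<phi> h" "\<phi> c = 1" "\<And>c'. c' \<in> B - {c} \<Longrightarrow> \<phi> c' = 0"
        using dual[OF True] by blast
      have \<phi>0: "\<phi> 0 = 0" using \<phi>(1)[of 0 0] by simp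
      have "\<phi> (h u) = of_int (Poly_Mapping.lookup u c)"
      proof (rule free_Abelian_group_induct[where P = "\<lambda>u. \<phi> (h u) = of_int (Poly_Mapping.lookup u c)", OF u(1)])
        show "\<phi> (h (frag_of a)) = of_int (Poly_Mapping.lookup (frag_of a) c)" if "a \<in> B" for a
          using \<phi>(2) \<phi>(3)[of a] that by (cases "a = c") (auto simp: hB lookup_single)
      qed (simp_all add: h0 \<phi>0 hdiff \<phi>(1) lookup_minus)
      then show ?thesis using u(2) \<phi>0 by simp
    next
      case False
      then show ?thesis using u(1) by (auto simp: in_keys_iff)
    qed
  qed
  have "h \<in> iso (free_Abelian_group B) ?A"
  proof (rule isoI[OF h bij_betw_imageI])
    show "inj_on h (carrier (free_Abelian_group B))"
    proof (rule inj_onI)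
      fix u v assume "u \<in> carrier (free_Abelian_group B)" "v \<in> carrier (free_Abelian_group B)" "h u = h v"
      then have "u - v = 0" using keys_diff[of u v] by (intro inj) (auto simp: hdiff)
      then show "u = v" by simp
    qed
    have "g \<in> h ` carrier (free_Abelian_group B)" if "g \<in> group_closure B" for g
      using that
    proof induction
      case (base c)
      then consider "c = 0" | "c \<in> B" by auto
      then show ?case
      proof cases
        case 1
        then show ?thesis using h0 by (intro image_eqI[of _ _ 0]) auto
      next
        case 2
        then show ?thesis using hB by (intro image_eqI[of _ _ "frag_of c"]) auto
      qed
    next
      case (diff x y)
      then obtain u v where "x = h u" "y = h v" "Poly_Mapping.keys u \<subseteq> B" "Poly_Mapping.keys v \<subseteq> B" by auto
      then show ?case using keys_diff[of u v] by (intro image_eqI[of _ _ "u - v"]) (auto simp: hdiff)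
    qed
    then show "h ` carrier (free_Abelian_group B) = carrier ?A" using h.hom_closed by auto
  qed
  then have "inv_into (carrier (free_Abelian_group B)) h \<in> iso ?A (free_Abelian_group B)"
    using group.iso_set_sym[OF group_free_Abelian_group] by blast
  then show ?thesis by (auto simp: iso_def bij_betw_def)
qed

section \<open>The rational vector space containing the groups\<close>

definition scale :: "rat \<Rightarrow> ('k \<Rightarrow>\<^sub>0 rat) \<Rightarrow> 'k \<Rightarrow>\<^sub>0 rat" where
  "scale q = Poly_Mapping.map ((*) q)"

lemma lookup_scale [simp]: "Poly_Mapping.lookup (scale q g) k = q * Poly_Mapping.lookup g k"
  by (simp add: scale_def Poly_Mapping.map.rep_eq when_def)

lemma scale_scale [simp]: "scale p (scale q g) = scale (p * q) g"
  by (rule poly_mapping_eqI) simp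

lemma scale_add_left: "scale (p + q) g = scale p g + scale q g"
  by (rule poly_mapping_eqI) (simp add: lookup_add algebra_simps)

lemma scale_diff_right: "scale p (g - h) = scale p g - scale p h"
  by (rule poly_mapping_eqI) (simp add: lookup_minus algebra_simps)

lemma scale_minus_left: "scale (- p) g = - scale p g"
  by (rule poly_mapping_eqI) simp

lemma scale_0 [simp]: "scale 0 g = 0" "scale q 0 = 0" and scale_1 [simp]: "scale 1 g = g"
  by (auto intro: poly_mapping_eqI)

lemma scale_int_in_group_closure:
  assumes "g \<in> group_closure S"
  shows "scale (of_int k) g \<in> group_closure S"
proof -
  have n: "scale (of_nat n) g \<in> group_closure S" for n
    by (induction n) (auto simp: scale_add_left assms intro: group_closure_add)
  show ?thesis
    using n[of "nat k"] n[of "nat (- k)"]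
    by (cases "k \<ge> 0") (auto simp: scale_minus_left)
qed

text \<open>The rational linear functional with value \<open>w k\<close> at the basis vector
  \<open>k\<close>.\<close>

definition weighted_sum :: "('k \<Rightarrow> rat) \<Rightarrow> ('k \<Rightarrow>\<^sub>0 rat) \<Rightarrow> rat" where
  "weighted_sum w g = (\<Sum>k\<in>Poly_Mapping.keys g. w k * Poly_Mapping.lookup g k)"

lemma weighted_sum_superset:
  assumes "finite A" "Poly_Mapping.keys g \<subseteq> A"
  shows "weighted_sum w g = (\<Sum>k\<in>A. w k * Poly_Mapping.lookup g k)"
  unfolding weighted_sum_def using assms by (intro sum.mono_neutral_left) (auto simp: in_keys_iff)

lemma weighted_sum_diff: "weighted_sum w (g - h) = weighted_sum w g - weighted_sum w h"
proof -
  let ?A = "Poly_Mapping.keys g \<union> Poly_Mapping.keys h"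
  have "Poly_Mapping.keys (g - h) \<subseteq> ?A" by (auto simp: in_keys_iff lookup_minus)
  then show ?thesis
    using weighted_sum_superset[of ?A g w] weighted_sum_superset[of ?A h w] weighted_sum_superset[of ?A "g - h" w]
    by (simp add: lookup_minus sum_subtractf right_diff_distrib)
qed

lemma weighted_sum_scale: "weighted_sum w (scale q g) = q * weighted_sum w g"
proof -
  have "Poly_Mapping.keys (scale q g) \<subseteq> Poly_Mapping.keys g" by (auto simp: in_keys_iff)
  then show ?thesis
    using weighted_sum_superset[of "Poly_Mapping.keys g" "scale q g" w]
    by (simp add: weighted_sum_def sum_distrib_left algebra_simps)
qed

lemma weighted_sum_single [simp]: "weighted_sum w (Poly_Mapping.single k 1) = w k"
  by (simp add: weighted_sum_def)

section \<open>Generators, relations and bases\<close>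

context twisted_family
begin

definition xg :: "'a \<times> 'a \<Rightarrow> ('a \<times> 'a) + 'i \<Rightarrow>\<^sub>0 rat" where
  "xg x = Poly_Mapping.single (Inl x) 1"

text \<open>Thus \<open>yg i n = (z - (\<Sum>k<n. k! a k)) / n!\<close> in the divisible hull, where \<open>z\<close> is the generator indexed
  by \<open>Inr i\<close>.\<close>

primrec yg :: "'i \<Rightarrow> nat \<Rightarrow> ('a \<times> 'a) + 'i \<Rightarrow>\<^sub>0 rat" where
  "yg i 0 = Poly_Mapping.single (Inr i) 1"
| "yg i (Suc n) = scale (1 / of_nat (Suc n)) (yg i n - (xg (s i n, b i n) - xg (s i n, b' i n)))"

lemma yg_step: "yg i n = scale (of_int (int (Suc n))) (yg i (Suc n)) + (xg (s i n, b i n) - xg (s i n, b' i n))"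
proof -
  have "(of_int (int (Suc n)) * (1 / of_nat (Suc n)) :: rat) = 1" by simp
  then show ?thesis unfolding yg.simps scale_scale by (simp del: of_nat_Suc)
qed

definition base_group :: "(('a \<times> 'a) + 'i \<Rightarrow>\<^sub>0 rat) set" where
  "base_group = group_closure (xg ` (R \<times> R))"

text \<open>The group \<open>G\<close> of the outline is \<open>twisted_group \<Lambda>\<close>, and
  \<open>base_group\<close> is \<open>F\<close>. Eventually disjoint \<open>I\<close> give free
  subgroups of \<open>G\<close>.\<close>

definition twisted_group :: "'i set \<Rightarrow> (('a \<times> 'a) + 'i \<Rightarrow>\<^sub>0 rat) set" where
  "twisted_group I = group_closure (xg ` (R \<times> R) \<union> {yg i n | i n. i \<in> I})"

lemma twisted_group_mono: "I \<subseteq> J \<Longrightarrow> twisted_group I \<subseteq> twisted_group J"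
  unfolding twisted_group_def by (rule group_closure_mono) auto

lemma xg_in: "x \<in> R \<times> R \<Longrightarrow> xg x \<in> twisted_group I"
  unfolding twisted_group_def by (rule group_closure.base) auto

lemma yg_in: "i \<in> I \<Longrightarrow> yg i n \<in> twisted_group I"
  unfolding twisted_group_def by (rule group_closure.base) auto

lemma twisted_group_diff: "g \<in> twisted_group I \<Longrightarrow> h \<in> twisted_group I \<Longrightarrow> g - h \<in> twisted_group I"
  unfolding twisted_group_def by (rule group_closure.diff)

lemma twisted_group_add: "g \<in> twisted_group I \<Longrightarrow> h \<in> twisted_group I \<Longrightarrow> g + h \<in> twisted_group I"
  unfolding twisted_group_def by (rule group_closure_add)

lemma scale_int_in_twisted_group: "g \<in> twisted_group I \<Longrightarrow> scale (of_int k) g \<in> twisted_group I"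
  unfolding twisted_group_def by (rule scale_int_in_group_closure)

lemma zero_in_twisted_group [simp]: "0 \<in> twisted_group I"
  by (simp add: twisted_group_def)

text \<open>A linear functional is prescribed by \<open>w\<close> on the generators
  \<open>xg\<close> and by \<open>v k 0\<close> at the start of each chain. The recursion for
  \<open>yg\<close> is that for \<open>v\<close> solved for the next term, so the two agree along
  the chain.\<close>

lemma functional_if_chain_solution:
  assumes "\<And>k n. k \<in> I \<Longrightarrow> v k n = int (Suc n) * v k (Suc n) + (w (s k n, b k n) - w (s k n, b' k n))"
  shows "\<exists>\<phi>. (\<forall>g h. \<phi> (g - h) = \<phi> g - \<phi> h) \<and> (\<forall>x. \<phi> (xg x) = of_int (w x)) \<and>
           (\<forall>k\<in>I. \<forall>n. \<phi> (yg k n) = (of_int (v k n) :: rat))"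
proof -
  define \<phi> where "\<phi> = weighted_sum (case_sum (\<lambda>x. of_int (w x)) (\<lambda>k. of_int (v k 0)))"
  have x: "\<phi> (xg x) = of_int (w x)" for x by (simp add: \<phi>_def xg_def)
  have y: "\<phi> (yg k n) = of_int (v k n)" if "k \<in> I" for k n
  proof (induction n)
    case 0
    show ?case by (simp add: \<phi>_def)
  next
    case (Suc n)
    have "\<phi> (yg k (Suc n)) = 1 / of_nat (Suc n) * (\<phi> (yg k n) - (\<phi> (xg (s k n, b k n)) - \<phi> (xg (s k n, b' k n))))"
      unfolding yg.simps by (simp only: \<phi>_def weighted_sum_scale weighted_sum_diff)
    also have "\<dots> = 1 / of_nat (Suc n) * of_int (v k n - (w (s k n, b k n) - w (s k n, b' k n)))"
      by (simp add: Suc.IH x)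
    also have "v k n - (w (s k n, b k n) - w (s k n, b' k n)) = int (Suc n) * v k (Suc n)"
      using assms[OF that, of n] by simp
    finally show ?case by (simp del: of_nat_Suc)
  qed
  show ?thesis by (rule exI[of _ \<phi>]) (use x y in \<open>auto simp: \<phi>_def weighted_sum_diff\<close>)
qed

lemma twisted_group_basis:
  assumes I: "I \<subseteq> \<Lambda>" "eventually_disjoint s I"
  shows "\<exists>B E. twisted_group I = group_closure B \<and> (\<forall>x\<in>R \<times> R - E. xg x \<in> B) \<and>
     (\<forall>a. \<exists>x0. \<forall>x. (a, x) \<in> E \<longrightarrow> x = x0) \<and>
     (\<forall>\<psi>. \<exists>w \<phi>. (\<forall>g h. \<phi> (g - h) = \<phi> g - \<phi> h) \<and> (\<forall>c\<in>B. \<phi> c = (of_int (\<psi> c) :: rat)) \<and>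
        (\<forall>x. \<phi> (xg x) = of_int (w x)) \<and>
        (\<forall>k\<in>I. solvable_chain (\<lambda>n. w (s k n, b k n) - w (s k n, b' k n))))"
proof -
  obtain N where N: "\<And>i j n m. i \<in> I \<Longrightarrow> j \<in> I \<Longrightarrow> n \<ge> N i \<Longrightarrow> m \<ge> N j \<Longrightarrow> s i n = s j m \<Longrightarrow> i = j"
    using I(2) unfolding eventually_disjoint_def by blast
  have uniq: "i = j" "n = m" if "i \<in> I" "j \<in> I" "n \<ge> N i" "m \<ge> N j" "s i n = s j m" for i j n m
  proof -
    show "i = j" by (rule N[OF that])
    then show "n = m" using that inj_s[of i] I(1) by (auto dest: injD)
  qed
  define E where "E = {(s i n, b i n) | i n. i \<in> I \<and> n \<ge> N i}"
  \<comment> \<open>By disjointness each row meets \<open>E\<close> at most once, so the relations express the generators in \<open>E\<close>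
    through the elements \<open>yg i n\<close> and the generators outside \<open>E\<close>.\<close>
  define B where "B = xg ` (R \<times> R - E) \<union> {yg i n | i n. i \<in> I \<and> n \<ge> N i}"
  \<comment> \<open>The other generator of a tail relation stays outside \<open>E\<close>, since
    disjointness would otherwise force \<open>b' i n = b i n\<close>.\<close>
  have b'E: "(s i n, b' i n) \<in> R \<times> R - E" if "i \<in> I" "n \<ge> N i" for i n
  proof -
    have iL: "i \<in> \<Lambda>" using that I by auto
    have "(s i n, b' i n) \<notin> E"
    proof
      assume "(s i n, b' i n) \<in> E"
      then obtain j m where j: "j \<in> I" "m \<ge> N j" "s i n = s j m" "b' i n = b j m" by (auto simp: E_def)
      then have "i = j" "n = m" using uniq[OF that(1) j(1) that(2) j(2) j(3)] by auto
      then show False using b_neq[OF iL] j(4) by metis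
    qed
    then show ?thesis using s_in[OF iL] b'_in[OF iL] by auto
  qed
  have yB: "yg i n \<in> group_closure B" if "i \<in> I" "n \<ge> N i" for i n
    by (rule group_closure.base) (use that in \<open>auto simp: B_def\<close>)
  have xB: "xg x \<in> group_closure B" if x: "x \<in> R \<times> R" for x
  proof (cases "x \<in> E")
    case True
    then obtain i n where i: "i \<in> I" "n \<ge> N i" "x = (s i n, b i n)" by (auto simp: E_def)
    have "xg (s i n, b' i n) \<in> group_closure B"
      by (rule group_closure.base) (use b'E[OF i(1,2)] in \<open>auto simp: B_def\<close>)
    then have "yg i n - scale (of_int (int (Suc n))) (yg i (Suc n)) + xg (s i n, b' i n) \<in> group_closure B"
      using i by (intro group_closure_add group_closure.diff scale_int_in_group_closure yB) auto
    also have "yg i n - scale (of_int (int (Suc n))) (yg i (Suc n)) + xg (s i n, b' i n) = xg x"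
      by (subst yg_step[of i n]) (simp add: i(3) del: yg.simps of_nat_Suc)
    finally show ?thesis .
  qed (rule group_closure.base, use x in \<open>auto simp: B_def\<close>)
  \<comment> \<open>Below \<open>N i\<close> the relations express \<open>yg i n\<close> through
    \<open>yg i (Suc n)\<close>, so the induction runs downwards.\<close>
  have yB': "yg i n \<in> group_closure B" if i: "i \<in> I" for i n
  proof (cases "n \<ge> N i")
    case False
    then have "n \<le> N i" by simp
    then show ?thesis
    proof (induction rule: inc_induct)
      case base
      then show ?case using yB i by simp
    next
      case (step n)
      have "i \<in> \<Lambda>" using i I by auto
      then have "xg (s i n, b i n) \<in> group_closure B" "xg (s i n, b' i n) \<in> group_closure B"
        using s_in b_in b'_in by (auto intro!: xB)
      then show ?case unfolding yg_step[of i n]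
        by (intro group_closure_add group_closure.diff scale_int_in_group_closure step)
    qed
  qed (use yB i in auto)
  have "twisted_group I = group_closure B"
  proof
    show "twisted_group I \<subseteq> group_closure B"
      unfolding twisted_group_def by (rule group_closure_least) (use xB yB' in auto)
    show "group_closure B \<subseteq> twisted_group I"
      unfolding twisted_group_def by (rule group_closure_mono) (auto simp: B_def)
  qed
  moreover have "\<forall>x\<in>R \<times> R - E. xg x \<in> B" by (auto simp: B_def)
  moreover have "\<exists>x0. \<forall>x. (a, x) \<in> E \<longrightarrow> x = x0" for a
  proof (cases "\<exists>x. (a, x) \<in> E")
    case True
    then obtain i n where i: "i \<in> I" "n \<ge> N i" "a = s i n" by (auto simp: E_def)
    have "x = b i n" if "(a, x) \<in> E" for x
    proof -
      obtain j m where j: "j \<in> I" "m \<ge> N j" "a = s j m" "x = b j m" using \<open>(a, x) \<in> E\<close> by (auto simp: E_def)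
      then show ?thesis using uniq[of i j n m] i by auto
    qed
    then show ?thesis by blast
  qed blast
  moreover have "\<exists>w \<phi>. (\<forall>g h. \<phi> (g - h) = \<phi> g - \<phi> h) \<and> (\<forall>c\<in>B. \<phi> c = (of_int (\<psi> c) :: rat)) \<and>
        (\<forall>x. \<phi> (xg x) = of_int (w x)) \<and>
        (\<forall>k\<in>I. solvable_chain (\<lambda>n. w (s k n, b k n) - w (s k n, b' k n)))" for \<psi>
  proof -
    \<comment> \<open>On \<open>E\<close> the relation forces the value; it is well defined because
      a point of \<open>E\<close> determines \<open>i\<close> and \<open>n\<close>.\<close>
    have "\<exists>z. (x \<notin> E \<longrightarrow> z = \<psi> (xg x)) \<and> (\<forall>i n. i \<in> I \<and> n \<ge> N i \<and> x = (s i n, b i n) \<longrightarrow>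
        z = \<psi> (yg i n) - int (Suc n) * \<psi> (yg i (Suc n)) + \<psi> (xg (s i n, b' i n)))" for x
    proof (cases "x \<in> E")
      case True
      then obtain i n where i: "i \<in> I" "n \<ge> N i" "x = (s i n, b i n)" by (auto simp: E_def)
      have "i = j \<and> n = m" if "j \<in> I" "m \<ge> N j" "x = (s j m, b j m)" for j m
        using uniq[OF i(1) that(1) i(2) that(2)] i(3) that(3) by auto
      then show ?thesis
        by (intro exI[of _ "\<psi> (yg i n) - int (Suc n) * \<psi> (yg i (Suc n)) + \<psi> (xg (s i n, b' i n))"])
          (use True in blast)
    qed (auto simp: E_def)
    then obtain w where w: "\<And>x. x \<notin> E \<Longrightarrow> w x = \<psi> (xg x)"
      "\<And>i n. i \<in> I \<Longrightarrow> n \<ge> N i \<Longrightarrow>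
        w (s i n, b i n) = \<psi> (yg i n) - int (Suc n) * \<psi> (yg i (Suc n)) + \<psi> (xg (s i n, b' i n))"
      by metis
    \<comment> \<open>By the choice of \<open>w\<close> the values of \<open>\<psi>\<close> at the
      basis elements \<open>yg k n\<close> solve the tail of the chain.\<close>
    have "\<exists>v. (\<forall>n. v n = int (Suc n) * v (Suc n) + (w (s k n, b k n) - w (s k n, b' k n))) \<and>
        (\<forall>n\<ge>N k. v n = \<psi> (yg k n))" if k: "k \<in> I" for k
    proof (rule chain_solution_from_tail)
      fix n assume n: "n \<ge> N k"
      have "w (s k n, b' k n) = \<psi> (xg (s k n, b' k n))" using b'E[OF k n] by (intro w(1)) auto
      then show "\<psi> (yg k n) = int (Suc n) * \<psi> (yg k (Suc n)) + (w (s k n, b k n) - w (s k n, b' k n))"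
        using w(2)[OF k n] by simp
    qed
    then obtain v where v: "\<And>k n. k \<in> I \<Longrightarrow> v k n = int (Suc n) * v k (Suc n) + (w (s k n, b k n) - w (s k n, b' k n))"
      "\<And>k n. k \<in> I \<Longrightarrow> n \<ge> N k \<Longrightarrow> v k n = \<psi> (yg k n)" by metis
    obtain \<phi> :: "_ \<Rightarrow> rat" where \<phi>: "\<forall>g h. \<phi> (g - h) = \<phi> g - \<phi> h" "\<forall>x. \<phi> (xg x) = of_int (w x)"
      "\<forall>k\<in>I. \<forall>n. \<phi> (yg k n) = of_int (v k n)"
      using functional_if_chain_solution[of I v w, OF v(1)] by blast
    have "\<forall>c\<in>B. \<phi> c = of_int (\<psi> c)" using \<phi>(2,3) w(1) v(2) by (auto simp: B_def)
    moreover have "solvable_chain (\<lambda>n. w (s k n, b k n) - w (s k n, b' k n))" if "k \<in> I" for k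
      unfolding solvable_chain_def by (intro exI[of _ "v k"] allI v(1) that)
    ultimately show ?thesis using \<phi>(1,2) by blast
  qed
  ultimately show ?thesis by blast
qed

end

text \<open>A function of finite support is coded by its graph on the support, and an infinite set
  has no more finite subsets than elements.\<close>

lemma card_of_finite_support_ordLeq:
  assumes inf: "infinite C" and A: "|A| \<le>o |C|" and V: "|UNIV :: 'v set| \<le>o |C|"
  shows "|{g :: 'k \<Rightarrow>\<^sub>0 'v::zero. Poly_Mapping.keys g \<subseteq> A}| \<le>o |C|"
proof -
  let ?P = "{g :: 'k \<Rightarrow>\<^sub>0 'v. Poly_Mapping.keys g \<subseteq> A}"
  let ?f = "\<lambda>g :: 'k \<Rightarrow>\<^sub>0 'v. (\<lambda>k. (k, Poly_Mapping.lookup g k)) ` Poly_Mapping.keys g"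
  have "inj_on ?f ?P"
  proof (rule inj_onI, rule poly_mapping_eqI)
    fix g h :: "'k \<Rightarrow>\<^sub>0 'v" and k assume e: "?f g = ?f h"
    have "(k, Poly_Mapping.lookup g k) \<in> ?f h" if "k \<in> Poly_Mapping.keys g" using that unfolding e[symmetric] by blast
    moreover have "(k, Poly_Mapping.lookup h k) \<in> ?f g" if "k \<in> Poly_Mapping.keys h" using that unfolding e by blast
    ultimately show "Poly_Mapping.lookup g k = Poly_Mapping.lookup h k"
      by (cases "k \<in> Poly_Mapping.keys g"; cases "k \<in> Poly_Mapping.keys h") (auto simp: in_keys_iff)
  qed
  moreover have "?f ` ?P \<subseteq> Fpow (A \<times> UNIV)" by (auto simp: Fpow_def)
  ultimately have "|?P| \<le>o |Fpow (A \<times> (UNIV :: 'v set))|" by (rule inj_on_imp_card_of_ordLeq)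
  moreover have "|Fpow (A \<times> (UNIV :: 'v set))| \<le>o |Fpow C|"
    by (intro card_of_Fpow_mono card_of_Times_ordLeq_infinite inf A V)
  moreover have "|Fpow C| \<le>o |C|" using card_of_Fpow_infinite[OF inf] by (rule ordIso_imp_ordLeq)
  ultimately show ?thesis by (metis ordLeq_transitive)
qed

section \<open>Free subgroups, divisibility modulo the base and lifting\<close>

context twisted_family
begin

text \<open>Characteristic functions of single elements of \<open>B\<close>, taken for
  \<open>\<psi>\<close>, give the dual functionals.\<close>

lemma twisted_group_embeds_free:
  assumes "I \<subseteq> \<Lambda>" "eventually_disjoint s I"
  shows "\<exists>(B :: (('a \<times> 'a) + 'i \<Rightarrow>\<^sub>0 rat) set) \<theta>. \<theta> \<in> hom (additive_group (twisted_group I)) (free_Abelian_group B) \<and> inj_on \<theta> (twisted_group I)"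
proof -
  obtain B where B: "twisted_group I = group_closure B"
    and dual: "\<And>\<psi>. \<exists>\<phi> :: _ \<Rightarrow> rat. (\<forall>g h. \<phi> (g - h) = \<phi> g - \<phi> h) \<and> (\<forall>c\<in>B. \<phi> c = of_int (\<psi> c))"
    using twisted_group_basis[OF assms] by (elim exE conjE) metis
  have "\<exists>\<theta>. \<theta> \<in> hom (additive_group (group_closure B)) (free_Abelian_group B) \<and> inj_on \<theta> (group_closure B)"
  proof (rule group_closure_embeds_free)
    fix c assume c: "c \<in> B"
    obtain \<phi> :: "_ \<Rightarrow> rat" where \<phi>: "\<forall>g h. \<phi> (g - h) = \<phi> g - \<phi> h" "\<forall>c'\<in>B. \<phi> c' = of_int (if c' = c then 1 else 0)"
      using dual[of "\<lambda>c'. if c' = c then 1 else 0"] by (elim exE conjE)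
    show "\<exists>\<phi> :: _ \<Rightarrow> rat. (\<forall>g h. \<phi> (g - h) = \<phi> g - \<phi> h) \<and> \<phi> c = 1 \<and> (\<forall>c'\<in>B - {c}. \<phi> c' = 0)"
      by (intro exI[of _ \<phi>] conjI) (use \<phi> c in auto)
  qed
  then show ?thesis unfolding B by (rule exI)
qed

lemma finite_index_support:
  assumes "g \<in> twisted_group \<Lambda>"
  shows "\<exists>I\<subseteq>\<Lambda>. finite I \<and> g \<in> twisted_group I"
  using assms unfolding twisted_group_def[of \<Lambda>]
proof induction
  case (base g)
  then consider "g = 0" | x where "x \<in> R \<times> R" "g = xg x" | i n where "i \<in> \<Lambda>" "g = yg i n" by auto
  then show ?case
  proof cases
    case 1
    then show ?thesis by (intro exI[of _ "{}"]) auto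
  next
    case 2
    then show ?thesis using xg_in by (intro exI[of _ "{}"]) auto
  next
    case 3
    then show ?thesis using yg_in[of i "{i}"] by (intro exI[of _ "{i}"]) auto
  qed
next
  case (diff g h)
  then obtain I J where IJ: "I \<subseteq> \<Lambda>" "finite I" "g \<in> twisted_group I" "J \<subseteq> \<Lambda>" "finite J" "h \<in> twisted_group J" by blast
  then have "g \<in> twisted_group (I \<union> J)" "h \<in> twisted_group (I \<union> J)"
    using twisted_group_mono[of I "I \<union> J"] twisted_group_mono[of J "I \<union> J"] by auto
  then show ?case using IJ by (intro exI[of _ "I \<union> J"]) (auto intro: twisted_group_diff)
qed

text \<open>Each element involves finitely many chains, so a countable set involves countably many,
  and these are eventually disjoint.\<close>

lemma countable_subset_embeds_free:
  assumes "A \<subseteq> twisted_group \<Lambda>" "countable A"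
  shows "\<exists>I (B :: (('a \<times> 'a) + 'i \<Rightarrow>\<^sub>0 rat) set) \<theta>. A \<subseteq> twisted_group I \<and>
    \<theta> \<in> hom (additive_group (twisted_group I)) (free_Abelian_group B) \<and> inj_on \<theta> (twisted_group I)"
proof -
  obtain J where J: "\<And>g. g \<in> A \<Longrightarrow> J g \<subseteq> \<Lambda> \<and> finite (J g) \<and> g \<in> twisted_group (J g)"
    using finite_index_support assms(1) by (metis subsetD)
  define I where "I = (\<Union>g\<in>A. J g)"
  have "I \<subseteq> \<Lambda>" "countable I" using J assms(2) by (auto simp: I_def intro: countable_finite)
  moreover have "A \<subseteq> twisted_group I"
  proof
    fix g assume g: "g \<in> A"
    then have "J g \<subseteq> I" by (auto simp: I_def)
    then show "g \<in> twisted_group I" using J[OF g] twisted_group_mono by blast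
  qed
  ultimately show ?thesis using twisted_group_embeds_free[OF _ countable_disjoint] by blast
qed

lemma base_group_subset: "base_group \<subseteq> twisted_group I"
  unfolding base_group_def twisted_group_def by (rule group_closure_mono) auto

lemma base_group_diff: "g \<in> base_group \<Longrightarrow> h \<in> base_group \<Longrightarrow> g - h \<in> base_group"
  unfolding base_group_def by (rule group_closure.diff)

lemma base_group_add: "g \<in> base_group \<Longrightarrow> h \<in> base_group \<Longrightarrow> g + h \<in> base_group"
  unfolding base_group_def by (rule group_closure_add)

lemma scale_int_in_base_group: "g \<in> base_group \<Longrightarrow> scale (of_int k) g \<in> base_group"
  unfolding base_group_def by (rule scale_int_in_group_closure)

text \<open>Modulo \<open>base_group\<close> the relations read
  \<open>yg i n = (n + 1) yg i (n + 1)\<close>, so \<open>c\<close> is the product of the numbers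
  from \<open>m + 1\<close> to \<open>M\<close>.\<close>

lemma yg_multiple_mod_base:
  assumes i: "i \<in> \<Lambda>" and "m \<le> M"
  shows "\<exists>c::int. yg i m - scale (of_int c) (yg i M) \<in> base_group"
  using \<open>m \<le> M\<close>
proof (induction M rule: dec_induct)
  case base
  show ?case by (intro exI[of _ 1]) (simp add: base_group_def)
next
  case (step n)
  then obtain c :: int where c: "yg i m - scale (of_int c) (yg i n) \<in> base_group" by blast
  have x: "xg (s i n, b i n) \<in> base_group" "xg (s i n, b' i n) \<in> base_group"
    unfolding base_group_def using s_in[OF i] b_in[OF i] b'_in[OF i] by (auto intro!: group_closure.base)
  define d where "d = xg (s i n, b i n) - xg (s i n, b' i n)"
  have "yg i n - d = scale (of_int (int (Suc n))) (yg i (Suc n))"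
    by (subst yg_step) (simp add: d_def del: yg.simps of_nat_Suc)
  then have "scale (of_int (c * int (Suc n))) (yg i (Suc n)) = scale (of_int c) (yg i n - d)"
    by (simp del: yg.simps of_nat_Suc)
  then have "yg i m - scale (of_int (c * int (Suc n))) (yg i (Suc n))
      = (yg i m - scale (of_int c) (yg i n)) + scale (of_int c) d"
    by (simp only: scale_diff_right) simp
  also have "\<dots> \<in> base_group"
    unfolding d_def by (rule base_group_add[OF c scale_int_in_base_group[OF base_group_diff[OF x]]])
  finally show ?case by blast
qed

text \<open>Every factor occurs far enough along a chain. This divisibility excludes freeness and
  makes maps modulo \<open>m\<close> determined by their values on
  \<open>base_group\<close>.\<close>

lemma divisible_mod_base:
  fixes n :: int
  assumes "n > 0" "g \<in> twisted_group \<Lambda>"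
  shows "\<exists>h\<in>twisted_group \<Lambda>. g - scale (of_int n) h \<in> base_group"
  using assms(2) unfolding twisted_group_def[of \<Lambda>]
proof induction
  case (base g)
  then consider "g \<in> base_group" | i m where "i \<in> \<Lambda>" "g = yg i m"
    by (auto simp: base_group_def intro: group_closure.base)
  then show ?case
  proof cases
    case 1
    then show ?thesis by (intro bexI[of _ 0]) auto
  next
    case (2 i m)
    \<comment> \<open>Then \<open>Suc M\<close> is a multiple of \<open>n\<close> and
      \<open>m \<le> M\<close>, so the step from \<open>M\<close> to \<open>Suc M\<close>
      contributes the factor \<open>n\<close>.\<close>
    define M where "M = nat n * Suc m - 1"
    have M: "Suc M = nat n * Suc m" using \<open>n > 0\<close> by (simp add: M_def)
    have "1 \<le> nat n" using \<open>n > 0\<close> by simp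
    then have "1 * Suc m \<le> nat n * Suc m" by (rule mult_le_mono1)
    then have "Suc m \<le> Suc M" unfolding M by (simp only: mult_1)
    then have "m \<le> M" by simp
    then obtain c :: int where c: "yg i m - scale (of_int c) (yg i M) \<in> base_group"
      using yg_multiple_mod_base[OF 2(1)] by blast
    have x: "xg (s i M, b i M) \<in> base_group" "xg (s i M, b' i M) \<in> base_group"
      unfolding base_group_def using s_in[OF 2(1)] b_in[OF 2(1)] b'_in[OF 2(1)] by (auto intro!: group_closure.base)
    define h where "h = scale (of_int (c * int (Suc m))) (yg i (Suc M))"
    have e: "n * (c * int (Suc m)) = c * int (Suc M)" unfolding M using \<open>n > 0\<close> by (simp add: algebra_simps)
    have "scale (of_int n) h = scale (of_int c) (scale (of_int (int (Suc M))) (yg i (Suc M)))"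
      unfolding h_def scale_scale of_int_mult[symmetric] e ..
    also have "\<dots> = scale (of_int c) (yg i M - (xg (s i M, b i M) - xg (s i M, b' i M)))"
      by (subst (2) yg_step) (simp del: yg.simps of_nat_Suc)
    finally have "g - scale (of_int n) h
        = (yg i m - scale (of_int c) (yg i M)) + scale (of_int c) (xg (s i M, b i M) - xg (s i M, b' i M))"
      unfolding 2(2) by (simp only: scale_diff_right[of _ "yg i M"]) simp
    also have "\<dots> \<in> base_group"
      by (rule base_group_add[OF c scale_int_in_base_group[OF base_group_diff[OF x]]])
    finally have "g - scale (of_int n) h \<in> base_group" .
    moreover have "h \<in> twisted_group \<Lambda>"
      unfolding h_def by (rule scale_int_in_twisted_group[OF yg_in[OF 2(1)]])
    ultimately show ?thesis unfolding twisted_group_def by blast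
  qed
next
  case (diff g h)
  then obtain g' h' where gh: "g' \<in> twisted_group \<Lambda>" "h' \<in> twisted_group \<Lambda>"
    "g - scale (of_int n) g' \<in> base_group" "h - scale (of_int n) h' \<in> base_group"
    unfolding twisted_group_def by blast
  have "(g - scale (of_int n) g') - (h - scale (of_int n) h') \<in> base_group"
    by (rule base_group_diff[OF gh(3,4)])
  then have "(g - h) - scale (of_int n) (g' - h') \<in> base_group" by (simp add: scale_diff_right algebra_simps)
  then show ?case using twisted_group_diff[OF gh(1,2)] unfolding twisted_group_def by blast
qed

text \<open>The assumption \<open>lifting\<close> reduces the task to eventually disjoint
  \<open>I\<close>, where \<open>f\<close> is lifted on a basis. The functional obtained agrees with
  \<open>f\<close> modulo \<open>m\<close> on \<open>base_group\<close>, hence by divisibility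
  everywhere.\<close>

lemma lift_additive_mod:
  fixes m :: int
  assumes f: "\<And>g h. g \<in> twisted_group \<Lambda> \<Longrightarrow> h \<in> twisted_group \<Lambda> \<Longrightarrow> m dvd f (g + h) - f g - f h"
  shows "\<exists>F. (\<forall>g\<in>twisted_group \<Lambda>. \<forall>h\<in>twisted_group \<Lambda>. F (g + h) = F g + F h) \<and>
             (\<forall>g\<in>twisted_group \<Lambda>. m dvd F g - f g)"
proof (cases "m = 0")
  case True
  then have "f (g + h) = f g + f h" if "g \<in> twisted_group \<Lambda>" "h \<in> twisted_group \<Lambda>" for g h
    using f[OF that] by simp
  then show ?thesis by (intro exI[of _ f]) simp
next
  case False
  let ?G = "twisted_group \<Lambda>"
  have f0: "m dvd f 0" using f[of 0 0] by simp
  have fd: "m dvd f (g - h) - (f g - f h)" if "g \<in> ?G" "h \<in> ?G" for g h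
  proof -
    have "m dvd f g - f (g - h) - f h" using f[OF twisted_group_diff[OF that] that(2)] by simp
    then have "m dvd - (f g - f (g - h) - f h)" by (simp only: dvd_minus_iff)
    then show ?thesis by (simp add: algebra_simps)
  qed
  \<comment> \<open>Agreement modulo \<open>m\<close> passes from generators to the closure; it is
    applied to a basis \<open>B\<close> and to the generators of \<open>base_group\<close>.\<close>
  have agree: "\<exists>z. \<phi> g = of_int z \<and> m dvd z - f g"
    if \<phi>: "\<And>g h. \<phi> (g - h) = \<phi> g - \<phi> h" and S: "\<And>c. c \<in> S \<Longrightarrow> \<exists>z. \<phi> c = of_int z \<and> m dvd z - f c"
      and SG: "group_closure S \<subseteq> ?G" and g: "g \<in> group_closure S" for \<phi> :: "_ \<Rightarrow> rat" and S g
    using g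
  proof induction
    case (base c)
    show ?case
    proof (cases "c = 0")
      case True
      then show ?thesis using \<phi>[of 0 0] f0 by (intro exI[of _ 0]) simp
    next
      case False
      then show ?thesis using base S by blast
    qed
  next
    case (diff g h)
    then obtain y z where yz: "\<phi> g = of_int y" "m dvd y - f g" "\<phi> h = of_int z" "m dvd z - f h" by blast
    have "m dvd (y - f g) - (z - f h) - (f (g - h) - (f g - f h))"
      by (intro dvd_diff[OF dvd_diff[OF yz(2,4)] fd]) (use diff SG in auto)
    then have "m dvd (y - z) - f (g - h)" by (simp add: algebra_simps)
    then show ?case using \<phi>[of g h] yz by (intro exI[of _ "y - z"]) simp
  qed
  have "\<exists>w. finite_rows R w \<and> (\<forall>x\<in>R \<times> R. m dvd w x - f (xg x)) \<and>
      (\<forall>k\<in>I. solvable_chain (\<lambda>n. w (s k n, b k n) - w (s k n, b' k n)))"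
    if I: "I \<subseteq> \<Lambda>" "eventually_disjoint s I" for I
  proof -
    obtain B E where B: "twisted_group I = group_closure B" "\<forall>x\<in>R \<times> R - E. xg x \<in> B"
      "\<forall>a. \<exists>x0. \<forall>x. (a, x) \<in> E \<longrightarrow> x = x0" and
      dual: "\<forall>\<psi>. \<exists>w \<phi>. (\<forall>g h. \<phi> (g - h) = \<phi> g - \<phi> h) \<and> (\<forall>c\<in>B. \<phi> c = (of_int (\<psi> c) :: rat)) \<and>
        (\<forall>x. \<phi> (xg x) = of_int (w x)) \<and>
        (\<forall>k\<in>I. solvable_chain (\<lambda>n. w (s k n, b k n) - w (s k n, b' k n)))"
      using twisted_group_basis[OF I] by (elim exE conjE) (rule that)
    \<comment> \<open>With residues modulo \<open>m\<close> as values on \<open>B\<close>, a row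
      takes finitely many values outside its at most one entry in \<open>E\<close>.\<close>
    obtain w \<phi> where \<phi>: "\<forall>g h. \<phi> (g - h) = \<phi> g - \<phi> h" "\<forall>c\<in>B. \<phi> c = (of_int (f c mod m) :: rat)"
        "\<forall>x. \<phi> (xg x) = of_int (w x)"
      and sol: "\<forall>k\<in>I. solvable_chain (\<lambda>n. w (s k n, b k n) - w (s k n, b' k n))"
      using dual[rule_format, of "\<lambda>c. f c mod m"] by (elim exE conjE) (rule that)
    have "m dvd w x - f (xg x)" if "x \<in> R \<times> R" for x
    proof -
      have "\<exists>z. \<phi> (xg x) = of_int z \<and> m dvd z - f (xg x)"
      proof (rule agree)
        show "\<exists>z. \<phi> c = of_int z \<and> m dvd z - f c" if "c \<in> B" for c
          using \<phi>(2) that by (intro exI[of _ "f c mod m"]) (simp add: mod_eq_dvd_iff[symmetric])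
        show "group_closure B \<subseteq> ?G" unfolding B(1)[symmetric] by (rule twisted_group_mono[OF I(1)])
        show "xg x \<in> group_closure B" unfolding B(1)[symmetric] by (rule xg_in[OF that])
      qed (use \<phi> in auto)
      then show ?thesis using \<phi>(3) by auto
    qed
    moreover have "finite_rows R w"
      unfolding finite_rows_def
    proof
      fix a assume a: "a \<in> R"
      obtain x0 where x0: "\<And>x. (a, x) \<in> E \<Longrightarrow> x = x0" using B(3) by blast
      have "w (a, x) \<in> insert (w (a, x0)) {- \<bar>m\<bar>..\<bar>m\<bar>}" if x: "x \<in> R" for x
      proof (cases "(a, x) \<in> E")
        case False
        then have "xg (a, x) \<in> B" using B(2) a x by auto
        then have "w (a, x) = f (xg (a, x)) mod m" using \<phi>(2,3) by (metis of_int_eq_iff)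
        then show ?thesis using abs_mod_less[OF \<open>m \<noteq> 0\<close>, of "f (xg (a, x))"] by auto
      qed (use x0 in auto)
      then have "(\<lambda>x. w (a, x)) ` R \<subseteq> insert (w (a, x0)) {- \<bar>m\<bar>..\<bar>m\<bar>}" by blast
      then show "finite ((\<lambda>x. w (a, x)) ` R)" by (rule finite_subset) simp
    qed
    ultimately show ?thesis using sol by blast
  qed
  then obtain w where w: "\<And>x. x \<in> R \<times> R \<Longrightarrow> m dvd w x - f (xg x)"
    and "\<forall>k\<in>\<Lambda>. solvable_chain (\<lambda>n. w (s k n, b k n) - w (s k n, b' k n))"
    using lifting[of m "\<lambda>x. f (xg x)"] by blast
  then obtain v where v: "\<And>k n. k \<in> \<Lambda> \<Longrightarrow> v k n = int (Suc n) * v k (Suc n) + (w (s k n, b k n) - w (s k n, b' k n))"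
    unfolding solvable_chain_def by metis
  obtain \<phi> :: "_ \<Rightarrow> rat" where \<phi>: "\<And>g h. \<phi> (g - h) = \<phi> g - \<phi> h" "\<And>x. \<phi> (xg x) = of_int (w x)"
      "\<And>k n. k \<in> \<Lambda> \<Longrightarrow> \<phi> (yg k n) = of_int (v k n)"
    using functional_if_chain_solution[of \<Lambda> v w, OF v] by blast
  have \<phi>0: "\<phi> 0 = 0" using \<phi>(1)[of 0 0] by simp
  have int: "\<exists>z::int. \<phi> g = of_int z" if "g \<in> ?G" for g
    using that unfolding twisted_group_def
  proof induction
    case (base g)
    then show ?case using \<phi>0 \<phi>(2,3) by (auto intro: exI[of _ 0])
  next
    case (diff g h)
    then show ?case using \<phi>(1) by (metis of_int_diff)
  qed
  have \<phi>add: "\<phi> (g + h) = \<phi> g + \<phi> h" for g h using \<phi>(1)[of "g + h" h] by simp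
  have scl: "\<exists>z. \<phi> (scale (of_int k) g) = of_int (k * z)" if g: "g \<in> ?G" for k g
  proof -
    obtain z where z: "\<phi> g = of_int z" using int[OF g] by blast
    have n: "\<phi> (scale (of_nat n) g) = of_nat n * \<phi> g" for n
      by (induction n) (auto simp: scale_add_left \<phi>add \<phi>0 algebra_simps)
    have "\<phi> (- h) = - \<phi> h" for h using \<phi>(1)[of 0 h] \<phi>0 by simp
    then have "\<phi> (scale (of_int k) g) = of_int k * \<phi> g"
      using n[of "nat k"] n[of "nat (- k)"] by (cases "k \<ge> 0") (auto simp: scale_minus_left)
    then show ?thesis using z by (intro exI[of _ z]) simp
  qed
  have fscl: "m dvd f (scale (of_int \<bar>m\<bar>) g)" if g: "g \<in> ?G" for g
  proof -
    have n: "m dvd f (scale (of_nat n) g) - of_nat n * f g" for n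
    proof (induction n)
      case 0
      show ?case using f0 by simp
    next
      case (Suc n)
      have "scale (of_nat n) g \<in> ?G"
        using g scale_int_in_group_closure[of g _ "int n"] by (simp add: twisted_group_def)
      then have "m dvd f (g + scale (of_nat n) g) - f g - f (scale (of_nat n) g)" by (rule f[OF g])
      then have "m dvd (f (g + scale (of_nat n) g) - f g - f (scale (of_nat n) g)) + (f (scale (of_nat n) g) - of_nat n * f g)"
        using Suc by (rule dvd_add)
      then show ?case by (simp add: scale_add_left algebra_simps)
    qed
    have "m dvd \<bar>m\<bar> * f g" by simp
    then show ?thesis using dvd_add[OF n[of "nat \<bar>m\<bar>"]] by fastforce
  qed
  \<comment> \<open>\<open>g\<close> differs from an element of \<open>base_group\<close> by
    \<open>\<bar>m\<bar>\<close> times some \<open>h\<close>, and on this multiple both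
    \<open>\<phi>\<close> and \<open>f\<close> vanish modulo \<open>m\<close>.\<close>
  have cong: "\<exists>z. \<phi> g = of_int z \<and> m dvd z - f g" if g: "g \<in> ?G" for g
  proof -
    obtain h where h: "h \<in> ?G" "g - scale (of_int \<bar>m\<bar>) h \<in> base_group"
      using divisible_mod_base[OF _ g, of "\<bar>m\<bar>"] False by auto
    let ?u = "g - scale (of_int \<bar>m\<bar>) h" and ?t = "scale (of_int \<bar>m\<bar>) h"
    have uG: "?u \<in> ?G" using h base_group_subset by blast
    have tG: "?t \<in> ?G" by (rule scale_int_in_twisted_group[OF h(1)])
    have "\<exists>z. \<phi> ?u = of_int z \<and> m dvd z - f ?u"
    proof (rule agree[of \<phi>])
      show "\<exists>z. \<phi> c = of_int z \<and> m dvd z - f c" if "c \<in> xg ` (R \<times> R)" for c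
        using that \<phi>(2) w by auto
      show "group_closure (xg ` (R \<times> R)) \<subseteq> ?G" using base_group_subset by (simp add: base_group_def)
      show "?u \<in> group_closure (xg ` (R \<times> R))" using h by (simp add: base_group_def)
    qed (rule \<phi>(1))
    then obtain y where y: "\<phi> ?u = of_int y" "m dvd y - f ?u" by blast
    obtain z where z: "\<phi> ?t = of_int (\<bar>m\<bar> * z)" using scl[OF h(1)] by blast
    have "\<phi> g = of_int (y + \<bar>m\<bar> * z)" using \<phi>add[of ?u ?t] y z by simp
    moreover have "m dvd (y - f ?u) + \<bar>m\<bar> * z - f ?t - (f (?u + ?t) - f ?u - f ?t)"
      by (intro dvd_diff dvd_add y fscl h f uG tG) simp
    ultimately show ?thesis by (intro exI[of _ "y + \<bar>m\<bar> * z"]) (simp add: algebra_simps)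
  qed
  \<comment> \<open>\<open>\<phi>\<close> takes integer values on the group; there the floor only
    changes the type.\<close>
  define F where "F g = \<lfloor>\<phi> g\<rfloor>" for g
  have F: "of_int (F g) = \<phi> g" if "g \<in> ?G" for g using int[OF that] by (auto simp: F_def)
  show ?thesis
  proof (intro exI[of _ F] conjI ballI)
    fix g h assume gh: "g \<in> ?G" "h \<in> ?G"
    have "(of_int (F (g + h)) :: rat) = of_int (F g + F h)" using F gh twisted_group_add by (simp add: \<phi>add)
    then show "F (g + h) = F g + F h" by (simp only: of_int_eq_iff)
  next
    fix g assume "g \<in> ?G"
    then show "m dvd F g - f g" using cong[of g] by (auto simp: F_def)
  qed
qed

section \<open>Cardinality and failure of freeness\<close>

lemma keys_twisted_group:
  assumes "g \<in> twisted_group \<Lambda>"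
  shows "Poly_Mapping.keys g \<subseteq> Inl ` (R \<times> R) \<union> Inr ` \<Lambda>"
proof -
  let ?K = "Inl ` (R \<times> R) \<union> Inr ` \<Lambda>"
  have d: "Poly_Mapping.keys (g - h) \<subseteq> ?K" if "Poly_Mapping.keys g \<subseteq> ?K" "Poly_Mapping.keys h \<subseteq> ?K"
    for g h :: "('a \<times> 'a) + 'i \<Rightarrow>\<^sub>0 rat"
    using that keys_diff[of g h] by blast
  have sc: "Poly_Mapping.keys (scale q g) \<subseteq> ?K" if "Poly_Mapping.keys g \<subseteq> ?K"
    for q and g :: "('a \<times> 'a) + 'i \<Rightarrow>\<^sub>0 rat"
  proof -
    have "Poly_Mapping.keys (scale q g) \<subseteq> Poly_Mapping.keys g" by (auto simp: in_keys_iff)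
    then show ?thesis using that by blast
  qed
  have x: "Poly_Mapping.keys (xg x) \<subseteq> ?K" if "x \<in> R \<times> R" for x using that by (auto simp: xg_def)
  have y: "Poly_Mapping.keys (yg i n) \<subseteq> ?K" if i: "i \<in> \<Lambda>" for i n
  proof (induction n)
    case 0
    then show ?case using i by simp
  next
    case (Suc n)
    show ?case unfolding yg.simps
      by (intro sc d Suc x) (use s_in[OF i] b_in[OF i] b'_in[OF i] in auto)
  qed
  from assms show ?thesis unfolding twisted_group_def
  proof induction
    case (base g)
    then consider "g = 0" | x where "x \<in> R \<times> R" "g = xg x" | i n where "i \<in> \<Lambda>" "g = yg i n" by blast
    then show ?case using x y by cases auto
  qed (rule d)
qed

lemma card_of_twisted_group:
  assumes "infinite \<Lambda>" "|R| \<le>o |\<Lambda>|"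
  shows "|twisted_group \<Lambda>| =o |\<Lambda>|"
proof -
  have "|Inl ` (R \<times> R) :: (('a \<times> 'a) + 'i) set| \<le>o |\<Lambda>|"
    by (rule ordLeq_transitive[OF card_of_image card_of_Times_ordLeq_infinite[OF assms(1,2,2)]])
  moreover have "|Inr ` \<Lambda> :: (('a \<times> 'a) + 'i) set| \<le>o |\<Lambda>|" by (rule card_of_image)
  ultimately have "|Inl ` (R \<times> R) \<union> Inr ` \<Lambda> :: (('a \<times> 'a) + 'i) set| \<le>o |\<Lambda>|"
    by (rule card_of_Un_ordLeq_infinite[OF assms(1)])
  moreover have "|UNIV :: rat set| \<le>o |\<Lambda>|"
    using infinite_iff_card_of_countable[of "UNIV :: rat set" \<Lambda>] assms(1) by (simp add: infinite_UNIV_char_0)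
  ultimately have le: "|{g :: ('a \<times> 'a) + 'i \<Rightarrow>\<^sub>0 rat. Poly_Mapping.keys g \<subseteq> Inl ` (R \<times> R) \<union> Inr ` \<Lambda>}| \<le>o |\<Lambda>|"
    by (rule card_of_finite_support_ordLeq[OF assms(1)])
  have "twisted_group \<Lambda> \<subseteq> {g. Poly_Mapping.keys g \<subseteq> Inl ` (R \<times> R) \<union> Inr ` \<Lambda>}"
    using keys_twisted_group by blast
  then have "|twisted_group \<Lambda>| \<le>o |\<Lambda>|"
    by (rule ordLeq_transitive[OF card_of_mono1 le])
  moreover have "|\<Lambda>| \<le>o |twisted_group \<Lambda>|"
  proof (rule inj_on_imp_card_of_ordLeq)
    show "inj_on (\<lambda>i. yg i 0) \<Lambda>"
    proof (rule inj_onI)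
      fix i j assume "yg i 0 = yg j 0"
      then have "Poly_Mapping.keys (yg i 0) = Poly_Mapping.keys (yg j 0)" by (rule arg_cong)
      then show "i = j" by simp
    qed
    show "(\<lambda>i. yg i 0) ` \<Lambda> \<subseteq> twisted_group \<Lambda>" using yg_in[of _ \<Lambda> 0] by auto
  qed
  ultimately show ?thesis by (simp add: ordIso_iff_ordLeq)
qed

text \<open>In a free group some coordinate would vanish on the small subgroup \<open>base_group\<close>, but the quotient
  by it is divisible.\<close>

lemma twisted_group_not_free:
  fixes S :: "'c set"
  assumes inf: "infinite R" and less: "|R| <o |\<Lambda>|"
  shows "\<not> additive_group (twisted_group \<Lambda>) \<cong> free_Abelian_group S"
proof
  let ?G = "twisted_group \<Lambda>"
  assume "additive_group ?G \<cong> free_Abelian_group S"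
  then obtain \<phi> where iso: "\<phi> \<in> iso (additive_group ?G) (free_Abelian_group S)" by (auto simp: is_iso_def)
  then have hom: "\<phi> \<in> hom (additive_group ?G) (free_Abelian_group S)" and bij: "bij_betw \<phi> ?G (carrier (free_Abelian_group S))"
    by (auto simp: iso_def)
  have add: "\<phi> (g + h) = \<phi> g + \<phi> h" if "g \<in> ?G" "h \<in> ?G" for g h
    using hom_mult[OF hom, of g h] that by simp
  have diff: "\<phi> (g - h) = \<phi> g - \<phi> h" if "g \<in> ?G" "h \<in> ?G" for g h
    using add[OF twisted_group_diff[OF that] that(2)] by simp
  have z: "\<phi> 0 = 0" using diff[of 0 0] by simp
  \<comment> \<open>These are the basis elements that occur in images of
    \<open>base_group\<close>.\<close>
  define B where "B = (\<Union>x\<in>R \<times> R. Poly_Mapping.keys (\<phi> (xg x)))"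
  have B: "|B| \<le>o |R|"
    unfolding B_def
  proof (rule card_of_UNION_ordLeq_infinite[OF inf])
    show "|R \<times> R| \<le>o |R|" by (intro card_of_Times_ordLeq_infinite inf ordIso_imp_ordLeq card_of_refl)
    show "\<forall>x\<in>R \<times> R. |Poly_Mapping.keys (\<phi> (xg x))| \<le>o |R|"
      using inf by (auto intro!: ordLess_imp_ordLeq finite_ordLess_infinite2)
  qed
  \<comment> \<open>Otherwise the group would have at most \<open>|R|\<close> elements, fewer than
    \<open>\<Lambda>\<close>.\<close>
  have "\<not> S \<subseteq> B"
  proof
    assume "S \<subseteq> B"
    then have "|S| \<le>o |R|" by (rule ordLeq_transitive[OF card_of_mono1 B])
    moreover have "|UNIV :: int set| \<le>o |R|"
      using infinite_iff_card_of_countable[of "UNIV :: int set" R] inf by simp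
    ultimately have "|{g :: 'c \<Rightarrow>\<^sub>0 int. Poly_Mapping.keys g \<subseteq> S}| \<le>o |R|"
      by (rule card_of_finite_support_ordLeq[OF inf])
    then have "|carrier (free_Abelian_group S)| \<le>o |R|" by (simp add: free_Abelian_group_def)
    moreover have "|?G| =o |carrier (free_Abelian_group S)|" using bij card_of_ordIso by blast
    ultimately have "|?G| \<le>o |R|" by (metis ordIso_ordLeq_trans)
    then have "|?G| <o |\<Lambda>|" by (rule ordLeq_ordLess_trans[OF _ less])
    moreover have "infinite \<Lambda>" using inf less card_of_ordLeq_finite ordLess_imp_ordLeq by blast
    then have "|\<Lambda>| =o |?G|" using card_of_twisted_group ordLess_imp_ordLeq[OF less] ordIso_symmetric by blast
    ultimately show False using not_ordLess_ordIso ordIso_symmetric by blast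
  qed
  then obtain c where c: "c \<in> S" "c \<notin> B" by blast
  have base: "Poly_Mapping.lookup (\<phi> u) c = 0" if "u \<in> base_group" for u
    using that unfolding base_group_def
  proof induction
    case (base u)
    then show ?case using c(2) z by (auto simp: B_def in_keys_iff)
  next
    case (diff g h)
    then have "g \<in> ?G" "h \<in> ?G" using base_group_subset by (auto simp: base_group_def)
    then show ?case using diff by (simp add: \<open>\<And>h g. g \<in> ?G \<Longrightarrow> h \<in> ?G \<Longrightarrow> \<phi> (g - h) = \<phi> g - \<phi> h\<close> lookup_minus)
  qed
  have "frag_of c \<in> \<phi> ` ?G" using bij c(1) by (simp add: bij_betw_def)
  then obtain g where g: "g \<in> ?G" "\<phi> g = frag_of c" by force
  \<comment> \<open>\<open>g\<close> is the sum of an element of \<open>base_group\<close> and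
    \<open>h + h\<close>; comparing coordinates at \<open>c\<close> would make 1 even.\<close>
  obtain h where h: "h \<in> ?G" "g - scale (of_int 2) h \<in> base_group" using divisible_mod_base[of 2, OF _ g(1)] by auto
  let ?u = "g - scale (of_int 2) h"
  have "?u \<in> ?G" using h base_group_subset by blast
  have "scale (of_int (1 + 1)) h = h + h" unfolding of_int_add scale_add_left by simp
  then have "g = ?u + (h + h)" by simp
  moreover have "\<phi> (?u + (h + h)) = \<phi> ?u + (\<phi> h + \<phi> h)"
    using \<open>?u \<in> ?G\<close> h(1) add[of ?u "h + h"] add[of h h] by (simp add: twisted_group_add)
  ultimately have "\<phi> g = \<phi> ?u + (\<phi> h + \<phi> h)" by simp
  then have "Poly_Mapping.lookup (frag_of c) c = 2 * Poly_Mapping.lookup (\<phi> h) c"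
    using base[OF h(2)] by (simp add: g(2) lookup_add)
  then have "(1::int) = 2 * Poly_Mapping.lookup (\<phi> h) c" by simp
  then show False by (metis dvd_triv_left odd_one)
qed

end

section \<open>Transfer to the required carrier type\<close>

lemma (in comm_group) comm_group_subgroup:
  assumes "subgroup H G"
  shows "comm_group (G\<lparr>carrier := H\<rparr>)"
proof (rule group.group_comm_groupI)
  show "group (G\<lparr>carrier := H\<rparr>)" by (rule subgroup_imp_group[OF assms])
  show "x \<otimes>\<^bsub>G\<lparr>carrier := H\<rparr>\<^esub> y = y \<otimes>\<^bsub>G\<lparr>carrier := H\<rparr>\<^esub> x"
    if "x \<in> carrier (G\<lparr>carrier := H\<rparr>)" "y \<in> carrier (G\<lparr>carrier := H\<rparr>)" for x y
    using that subgroup.mem_carrier[OF assms] by (simp add: m_comm)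
qed

lemma (in comm_group) comm_group_image_group:
  assumes "inj_on f (carrier G)"
  shows "comm_group (image_group f G)"
proof -
  have "image_group f G\<lparr>one := f \<one>\<rparr> = image_group f G" by (simp add: image_group_def)
  then show ?thesis using iso_imp_img_comm_group[OF inj_imp_image_group_iso[OF assms]] by simp
qed

text \<open>Countable subgroups of \<open>M\<close> have countable images under \<open>u\<close>,
  and the maps to be lifted are composed with the inverse of \<open>u\<close>, their lifts with
  \<open>u\<close>.\<close>

lemma (in twisted_family) coseparable_if_iso_twisted_group:
  assumes M: "comm_group M" and iso: "u \<in> iso M (additive_group (twisted_group \<Lambda>))"
  shows "coseparable M"
proof -
  interpret M: comm_group M by (rule M)
  let ?G = "twisted_group \<Lambda>"
  have u: "u (x \<otimes>\<^bsub>M\<^esub> y) = u x + u y" if "x \<in> carrier M" "y \<in> carrier M" for x y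
    using iso that by (simp add: iso_def hom_def)
  have bij: "bij_betw u (carrier M) ?G" using iso by (simp add: iso_def)
  let ?t = "inv_into (carrier M) u"
  have uG: "u x \<in> ?G" if "x \<in> carrier M" for x using bij that by (auto simp: bij_betw_def)
  have tM: "?t g \<in> carrier M" "u (?t g) = g" if "g \<in> ?G" for g
    using bij that by (auto simp: bij_betw_def intro: inv_into_into f_inv_into_f)
  have tu: "?t (u x) = x" if "x \<in> carrier M" for x
    using bij that by (auto simp: bij_betw_def)
  have tadd: "?t (g + h) = ?t g \<otimes>\<^bsub>M\<^esub> ?t h" if "g \<in> ?G" "h \<in> ?G" for g h
    using tu[of "?t g \<otimes>\<^bsub>M\<^esub> ?t h"] u[of "?t g" "?t h"] tM that by simp
  have "aleph1_free M"
    unfolding aleph1_free_def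
  proof (intro conjI allI impI M)
    fix H assume H: "subgroup H M \<and> countable H"
    then have HM: "H \<subseteq> carrier M" by (simp add: subgroup.subset)
    have uH: "u ` H \<subseteq> ?G" "countable (u ` H)" using H HM uG by auto
    obtain I and B :: "(('a \<times> 'a) + 'i \<Rightarrow>\<^sub>0 rat) set" and \<theta> where
      I: "u ` H \<subseteq> twisted_group I" and \<theta>: "\<theta> \<in> hom (additive_group (twisted_group I)) (free_Abelian_group B)"
        "inj_on \<theta> (twisted_group I)"
      using countable_subset_embeds_free[OF uH] by (elim exE conjE) (rule that)
    show "free_abelian (M\<lparr>carrier := H\<rparr>)"
    proof (rule free_abelian_if_embeds)
      show "comm_group (M\<lparr>carrier := H\<rparr>)" using H by (simp add: M.comm_group_subgroup)
      show "\<theta> \<circ> u \<in> hom (M\<lparr>carrier := H\<rparr>) (free_Abelian_group B)"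
      proof (rule homI)
        fix x y assume "x \<in> carrier (M\<lparr>carrier := H\<rparr>)" "y \<in> carrier (M\<lparr>carrier := H\<rparr>)"
        then have xy: "u x \<in> twisted_group I" "u y \<in> twisted_group I" "x \<in> carrier M" "y \<in> carrier M"
          using I HM by auto
        show "(\<theta> \<circ> u) x \<in> carrier (free_Abelian_group B)" using hom_in_carrier[OF \<theta>(1), of "u x"] xy by simp
        show "(\<theta> \<circ> u) (x \<otimes>\<^bsub>M\<lparr>carrier := H\<rparr>\<^esub> y) = (\<theta> \<circ> u) x \<otimes>\<^bsub>free_Abelian_group B\<^esub> (\<theta> \<circ> u) y"
          using hom_mult[OF \<theta>(1), of "u x" "u y"] xy by (simp add: u)
      qed
      have "inj_on u H" using bij HM by (auto simp: bij_betw_def intro: inj_on_subset)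
      then show "inj_on (\<theta> \<circ> u) (carrier (M\<lparr>carrier := H\<rparr>))"
        using inj_on_subset[OF \<theta>(2) I] by (simp add: comp_inj_on)
    qed
  qed
  moreover have "\<exists>h. (\<forall>a\<in>carrier M. \<forall>b\<in>carrier M. h (a \<otimes>\<^bsub>M\<^esub> b) = h a + h b) \<and> (\<forall>a\<in>carrier M. n dvd h a - f a)"
    if f: "\<And>a b. a \<in> carrier M \<Longrightarrow> b \<in> carrier M \<Longrightarrow> n dvd f (a \<otimes>\<^bsub>M\<^esub> b) - f a - f b" for n :: int and f
  proof -
    obtain F where F: "\<And>g h. g \<in> ?G \<Longrightarrow> h \<in> ?G \<Longrightarrow> F (g + h) = F g + F h" "\<And>g. g \<in> ?G \<Longrightarrow> n dvd F g - f (?t g)"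
      using lift_additive_mod[of n "\<lambda>g. f (?t g)"] f tM(1) tadd by (metis (no_types, lifting))
    show ?thesis
      by (intro exI[of _ "F \<circ> u"] conjI ballI) (use F uG u tu F(2)[OF uG] in auto)
  qed
  ultimately show ?thesis by (rule M.coseparable_if_lifting)
qed

theorem theorem2p11:
  fixes lam :: "'a rel"
  assumes "Card_order lam"
    and "has_cofinality lam natLeq"
    and "ctwo ^c lam =o cardSuc lam"
    and "\<forall>mu :: 'a rel. Card_order mu \<and> mu <o lam \<longrightarrow> ctwo ^c mu <o lam"
    and "star_aleph0 lam"
  shows "\<exists>G :: 'a set monoid. comm_group G \<and> coseparable G \<and> \<not> free_abelian G \<and>
           |carrier G| =o cardSuc lam"
proof -
  let ?R = "Field lam" and ?L = "Field (cardSuc lam)"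
  obtain s b b' where "twisted_family ?R ?L s b b'" using twisted_family_exists[OF assms] by blast
  then interpret twisted_family ?R ?L s b b' .
  let ?A = "additive_group (twisted_group ?L)"
  have A: "comm_group ?A" unfolding twisted_group_def by (rule comm_group_additive_group)
  have R: "|?R| =o lam" and L: "|?L| =o cardSuc lam"
    using assms(1) by (simp_all add: card_of_Field_ordIso cardSuc_Card_order)
  have inf: "infinite ?R" by (rule cofinality_omega_infinite_Field[OF assms(2)])
  have less: "|?R| <o |?L|"
    by (rule ordIso_ordLess_trans[OF R ordLess_ordIso_trans[OF cardSuc_greater[OF assms(1)] ordIso_symmetric[OF L]]])
  have infL: "infinite ?L" using inf cardSuc_finite[OF assms(1)] by simp
  have card: "|twisted_group ?L| =o |?L|" by (rule card_of_twisted_group[OF infL ordLess_imp_ordLeq[OF less]])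
  then obtain t where t: "bij_betw t (twisted_group ?L) ?L"
    using card_of_ordIso[of "twisted_group ?L" ?L] by blast
  \<comment> \<open>The group consists of finitely supported functions; it is copied onto
    \<open>?L\<close>, whose elements have the type \<open>'a set\<close> required of the
    carrier.\<close>
  define M where "M = image_group t ?A"
  have inj: "inj_on t (carrier ?A)" using t by (simp add: bij_betw_def)
  have M: "comm_group M" unfolding M_def by (rule comm_group.comm_group_image_group[OF A inj])
  have iso: "t \<in> iso ?A M" unfolding M_def by (rule inj_imp_image_group_iso[OF inj])
  have "group ?A" using A by (simp add: comm_group_def)
  then have inv: "inv_into (carrier ?A) t \<in> iso M ?A" using iso by (rule group.iso_set_sym)
  have "carrier M = ?L" using t by (simp add: M_def image_group_carrier bij_betw_def)
  then have "|carrier M| =o cardSuc lam" using L by simp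
  moreover have "\<not> free_abelian M"
  proof
    assume "free_abelian M"
    then obtain S :: "'a set set" where "M \<cong> free_Abelian_group S" by (auto simp: free_abelian_def)
    moreover have "?A \<cong> M" using iso by (auto simp: is_iso_def)
    ultimately have "?A \<cong> free_Abelian_group S" using iso_trans by blast
    then show False using twisted_group_not_free[OF inf less] by blast
  qed
  moreover have "coseparable M" by (rule coseparable_if_iso_twisted_group[OF M inv])
  ultimately show ?thesis using M by blast
qed

end
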